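(* Let $1\to G\to H\xrightarrow{j} Q\to 1$ be an extension of a finite group $Q$ by a finite group $G$, with $H$ identified with $G\rtimes_{s,\tau}Q$ by means of a section $s$ of $j$ with $s(1)=1$ and its associated map $\tau:Q\times Q\to G$. For $[\rho]\in\widehat{G}$, let $\chi^G_\rho$ be the character of the $G$-representation $V_\rho$. Then for every $(g_1,g_2)\in G\times G$, $$\sum_{[\rho]\in\widehat{G}}\ \sum_{q\in Q}\chi^G_\rho(g_1^{-1})\,\chi^G_{q([\rho])}(g_2)=\begin{cases}|C_H(g_1)|, & \text{if } g_1 \text{ and } g_2 \text{ are conjugate in } H,\\ 0, & \text{otherwise.}\end{cases}$$
   Context: All groups are finite. $G$ is regarded as a normal subgroup of $H$ (the kernel of $j$). $C_H(h)$ denotes the centralizer of $h$ in $H$ and $|C_H(h)|$ its number of elements. Section and $\tau$: fix a map $s:Q\to H$ with $j\circ s=\mathrm{id}$ and $s(1)=1$, and put $\tau(q_1,q_2):=s(q_1)s(q_2)s(q_1q_2)^{-1}\in G$. $G\rtimes_{s,\tau}Q$ is the set $G\times Q$ with the product $(g_1,q_1)\cdot(g_2,q_2)=(g_1\,\mathrm{Ad}_{s(q_1)}(g_2)\,\tau(q_1,q_2),\,q_1q_2)$, where $\mathrm{Ad}_h(g)=hgh^{-1}$; the map $h\mapsto (h\,s(j(h))^{-1},j(h))$ is a group isomorphism $H\to G\rtimes_{s,\tau}Q$. Action on $\widehat{G}$: $\widehat{G}$ is the set of isomorphism classes of irreducible complex representations of $G$; for each class $[\rho]\in\widehat{G}$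 a representative $\rho:G\to\mathrm{End}(V_\rho)$ on a finite-dimensional complex vector space is chosen. For $q\in Q$, $q([\rho])\in\widehat{G}$ denotes the class of the representation $g\mapsto\rho(\mathrm{Ad}_{s(q)}(g))$ (independent of the choice of $s$), and $\chi^G_{q([\rho])}$ is the character of a representation in this class. *)

theory Defs
  imports "HOL-Algebra.Algebra" "Jordan_Normal_Form.VS_Connect"
begin

section \<open>Complex representations of a finite group\<close>

text \<open>Finite-dimensional complex representations are taken on the coordinate spaces
  \<open>carrier_vec n\<close>. Every finite-dimensional complex vector space is isomorphic to one of
  them, so every isomorphism class of representations has such members. Only the values of
  \<open>\<rho>\<close> on the carrier of the group matter; \<open>rep_iso\<close> ignores all others.\<close>

type_synonym 'a rep = "'a \<Rightarrow> complex mat"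

definition representation :: "'a monoid \<Rightarrow> nat \<Rightarrow> 'a rep \<Rightarrow> bool" where
  "representation G n \<rho> \<longleftrightarrow> \<rho> \<in> hom G (units_of (ring_mat TYPE(complex) n ()))"

definition irreducible_rep :: "'a monoid \<Rightarrow> nat \<Rightarrow> 'a rep \<Rightarrow> bool" where
  "irreducible_rep G n \<rho> \<longleftrightarrow> representation G n \<rho> \<and> n \<noteq> 0 \<and>
     (\<forall>W. VectorSpace.subspace class_ring W (module_vec TYPE(complex) n) \<and>
          (\<forall>g\<in>carrier G. \<forall>w\<in>W. \<rho> g *\<^sub>v w \<in> W)
        \<longrightarrow> W = {0\<^sub>v n} \<or> W = carrier_vec n)"

definition irreps :: "'a monoid \<Rightarrow> 'a rep set" where
  "irreps G = {\<rho>. \<exists>n. irreducible_rep G n \<rho>}"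

definition rep_iso :: "'a monoid \<Rightarrow> 'a rep \<Rightarrow> 'a rep \<Rightarrow> bool" where
  "rep_iso G \<rho> \<sigma> \<longleftrightarrow> (\<exists>n. representation G n \<rho> \<and> representation G n \<sigma> \<and>
     (\<exists>P\<in>Units (ring_mat TYPE(complex) n ()). \<forall>g\<in>carrier G. P * \<rho> g = \<sigma> g * P))"

definition irrep_rel :: "'a monoid \<Rightarrow> ('a rep \<times> 'a rep) set" where
  "irrep_rel G = {(\<rho>, \<sigma>). \<rho> \<in> irreps G \<and> \<sigma> \<in> irreps G \<and> rep_iso G \<rho> \<sigma>}"

definition irr_classes :: "'a monoid \<Rightarrow> 'a rep set set" where
  "irr_classes G = irreps G // irrep_rel G"

definition character :: "'a rep \<Rightarrow> 'a \<Rightarrow> complex" where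
  "character \<rho> g = (\<Sum>i<dim_row (\<rho> g). \<rho> g $$ (i, i))"

section \<open>Conjugation\<close>

definition Ad :: "'h monoid \<Rightarrow> 'h \<Rightarrow> 'h \<Rightarrow> 'h" where
  "Ad H h g = h \<otimes>\<^bsub>H\<^esub> g \<otimes>\<^bsub>H\<^esub> inv\<^bsub>H\<^esub> h"

definition conjugate_in :: "'h monoid \<Rightarrow> 'h \<Rightarrow> 'h \<Rightarrow> bool" where
  "conjugate_in H x y \<longleftrightarrow> (\<exists>h\<in>carrier H. Ad H h x = y)"

definition centralizer :: "'h monoid \<Rightarrow> 'h \<Rightarrow> 'h set" where
  "centralizer H x = {h \<in> carrier H. h \<otimes>\<^bsub>H\<^esub> x = x \<otimes>\<^bsub>H\<^esub> h}"

section \<open>Extensions with a section\<close>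

text \<open>An extension is a surjective homomorphism \<open>j\<close> from \<open>H\<close> to \<open>Q\<close>; the group \<open>G\<close> is the
  kernel of \<open>j\<close>, as a subgroup of \<open>H\<close>.\<close>

definition kernel_group :: "'h monoid \<Rightarrow> 'q monoid \<Rightarrow> ('h \<Rightarrow> 'q) \<Rightarrow> 'h monoid" where
  "kernel_group H Q j = H\<lparr>carrier := kernel H Q j\<rparr>"

definition normalized_section ::
    "'h monoid \<Rightarrow> 'q monoid \<Rightarrow> ('h \<Rightarrow> 'q) \<Rightarrow> ('q \<Rightarrow> 'h) \<Rightarrow> bool" where
  "normalized_section H Q j s \<longleftrightarrow>
     s \<in> carrier Q \<rightarrow> carrier H \<and> (\<forall>q\<in>carrier Q. j (s q) = q) \<and> s \<one>\<^bsub>Q\<^esub> = \<one>\<^bsub>H\<^esub>"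

text \<open>The action of \<open>q\<close> on isomorphism classes; \<open>R c\<close> is the chosen representative of the
  class \<open>c\<close>.\<close>

definition q_act ::
    "'h monoid \<Rightarrow> 'h monoid \<Rightarrow> ('q \<Rightarrow> 'h) \<Rightarrow> ('h rep set \<Rightarrow> 'h rep) \<Rightarrow> 'q
      \<Rightarrow> 'h rep set \<Rightarrow> 'h rep set" where
  "q_act G H s R q c = irrep_rel G `` {\<lambda>g. R c (Ad H (s q) g)}"

definition tau :: "'h monoid \<Rightarrow> 'q monoid \<Rightarrow> ('q \<Rightarrow> 'h) \<Rightarrow> 'q \<Rightarrow> 'q \<Rightarrow> 'h" where
  "tau H Q s q1 q2 = s q1 \<otimes>\<^bsub>H\<^esub> s q2 \<otimes>\<^bsub>H\<^esub> inv\<^bsub>H\<^esub> (s (q1 \<otimes>\<^bsub>Q\<^esub> q2))"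

definition crossed_product ::
    "'h monoid \<Rightarrow> 'q monoid \<Rightarrow> ('h \<Rightarrow> 'q) \<Rightarrow> ('q \<Rightarrow> 'h) \<Rightarrow> ('h \<times> 'q) monoid" where
  "crossed_product H Q j s =
     \<lparr>carrier = kernel H Q j \<times> carrier Q,
      Group.monoid.mult = (\<lambda>(g1, q1) (g2, q2).
        (g1 \<otimes>\<^bsub>H\<^esub> Ad H (s q1) g2 \<otimes>\<^bsub>H\<^esub> tau H Q s q1 q2, q1 \<otimes>\<^bsub>Q\<^esub> q2)),
      one = (\<one>\<^bsub>H\<^esub>, \<one>\<^bsub>Q\<^esub>)\<rparr>"

text \<open>The identification of \<open>H\<close> with the crossed product. It sends each \<open>g\<close> in the kernel to
  \<open>(g, 1)\<close>, so conjugacy and centralizers of elements of the kernel may be taken in \<open>H\<close>.\<close>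

lemma crossed_product_iso:
  assumes H: "group H" and Q: "group Q" and j: "j \<in> hom H Q"
    and s: "normalized_section H Q j s"
  shows "(\<lambda>h. (h \<otimes>\<^bsub>H\<^esub> inv\<^bsub>H\<^esub> (s (j h)), j h)) \<in> iso H (crossed_product H Q j s)"
    (is "?f \<in> _")
proof -
  interpret H: group H by (rule H)
  interpret Q: group Q by (rule Q)
  interpret J: group_hom H Q j by unfold_locales (rule j)
  have sc[simp]: "s q \<in> carrier H" "j (s q) = q" if "q \<in> carrier Q" for q
    using s that by (auto simp: normalized_section_def)
  have cancel: "a \<otimes>\<^bsub>H\<^esub> (inv\<^bsub>H\<^esub> a \<otimes>\<^bsub>H\<^esub> b) = b" "inv\<^bsub>H\<^esub> a \<otimes>\<^bsub>H\<^esub> (a \<otimes>\<^bsub>H\<^esub> b) = b"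
    if "a \<in> carrier H" "b \<in> carrier H" for a b
    using that by (simp_all add: H.m_assoc[symmetric])
  have hom: "?f \<in> hom H (crossed_product H Q j s)"
    by (rule homI)
      (auto simp: crossed_product_def kernel_def tau_def Ad_def H.m_assoc cancel)
  have "bij_betw ?f (carrier H) (carrier (crossed_product H Q j s))"
    by (rule bij_betwI[where g = "\<lambda>(g, q). g \<otimes>\<^bsub>H\<^esub> s q"])
      (auto simp: crossed_product_def kernel_def H.m_assoc)
  with hom show ?thesis
    by (simp add: iso_def)
qed

lemma crossed_product_iso_kernel:
  assumes "group H" and "normalized_section H Q j s" and "g \<in> kernel H Q j"
  shows "(g \<otimes>\<^bsub>H\<^esub> inv\<^bsub>H\<^esub> (s (j g)), j g) = (g, \<one>\<^bsub>Q\<^esub>)"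
proof -
  interpret group H by fact
  show ?thesis using assms by (simp add: kernel_def normalized_section_def)
qed

end

theory Submission
  imports Defs "Jordan_Normal_Form.DL_Rank" "Jordan_Normal_Form.Spectral_Radius"
begin

text \<open>The action of \<open>q\<close> turns \<open>\<chi>\<^bsub>q(\<rho>)\<^esub>(g\<^sub>2)\<close> into \<open>\<chi>\<^sub>\<rho>(s(q) g\<^sub>2 s(q)\<^sup>-\<^sup>1)\<close>, so for each \<open>q\<close> column
  orthogonality in \<open>G\<close> counts the \<open>g \<in> G\<close> for which \<open>g s(q)\<close> conjugates \<open>g\<^sub>2\<close> into \<open>g\<^sub>1\<close>. Every element of
  \<open>H\<close> is uniquely of the form \<open>g s(q)\<close>; hence the double sum counts the elements of \<open>H\<close> conjugating
  \<open>g\<^sub>2\<close> into \<open>g\<^sub>1\<close>, which form a coset of the centralizer of \<open>g\<^sub>1\<close> or the empty set.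

  Column orthogonality comes from Schur's lemma: \<open>n\<^sub>\<rho> \<Sum>\<^sub>h \<chi>\<^sub>\<rho>(x\<^sup>-\<^sup>1 h y h\<^sup>-\<^sup>1) = |G| \<chi>\<^sub>\<rho>(x\<^sup>-\<^sup>1) \<chi>\<^sub>\<rho>(y)\<close>. Summed
  over \<open>\<rho>\<close>, the left-hand side becomes the regular character \<open>\<Sum>\<^sub>\<rho> n\<^sub>\<rho> \<chi>\<^sub>\<rho>\<close>, which vanishes off the
  identity. For the decomposition of the regular character complete reducibility is not needed: in a
  basis adapted to an invariant subspace the matrices are block triangular, and the character is the
  sum of the characters of the diagonal blocks.\<close>

section \<open>Traces and representations\<close>

text \<open>The trace of a single matrix. \<open>character\<close> speaks only of values of a
  representation, whereas averages and products need a trace as well.\<close>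

definition tr :: "complex mat \<Rightarrow> complex" where
  "tr A = (\<Sum>i<dim_row A. A $$ (i, i))"

lemma character_eq_tr: "character \<rho> g = tr (\<rho> g)"
  by (simp add: character_def tr_def)

lemma tr_one [simp]: "tr (1\<^sub>m n) = of_nat n"
  by (simp add: tr_def)

lemma tr_smult [simp]: "tr (c \<cdot>\<^sub>m A) = c * tr A" if "A \<in> carrier_mat n n"
  using that by (auto simp: tr_def sum_distrib_left)

lemma tr_mult:
  assumes "A \<in> carrier_mat n m" "B \<in> carrier_mat m n"
  shows "tr (A * B) = (\<Sum>i<n. \<Sum>j<m. A $$ (i, j) * B $$ (j, i))"
  using assms unfolding tr_def
  by (auto simp: scalar_prod_def atLeast0LessThan intro!: sum.cong)

lemma tr_comm:
  assumes "A \<in> carrier_mat n m" "B \<in> carrier_mat m n"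
  shows "tr (A * B) = tr (B * A)"
  unfolding tr_mult[OF assms] tr_mult[OF assms(2,1)]
  by (subst sum.swap) (simp add: mult.commute)

text \<open>Invertibility of \<open>\<rho> g\<close> follows from multiplicativity, with
  \<open>\<rho> (inv g)\<close> as the inverse. This turns checking that an explicit family of
  matrices is a representation into plain matrix identities.\<close>

lemma representation_iff:
  assumes "group G"
  shows "representation G n \<rho> \<longleftrightarrow>
    (\<forall>g\<in>carrier G. \<rho> g \<in> carrier_mat n n) \<and> \<rho> \<one>\<^bsub>G\<^esub> = 1\<^sub>m n \<and>
    (\<forall>g\<in>carrier G. \<forall>h\<in>carrier G. \<rho> (g \<otimes>\<^bsub>G\<^esub> h) = \<rho> g * \<rho> h)" (is "?l \<longleftrightarrow> ?r")
proof -
  interpret G: group G by fact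
  let ?M = "ring_mat TYPE(complex) n ()"
  interpret M: ring ?M by (rule ring_mat)
  have grp: "group (units_of ?M)"
    by (rule M.units_group)
  show ?thesis
  proof
    assume l: ?l
    then have h: "\<rho> \<in> hom G (units_of ?M)" by (simp add: representation_def)
    then interpret h: group_hom G "units_of ?M" \<rho>
      using grp by (simp add: group_hom_def group_hom_axioms_def assms)
    show ?r
      using h h.hom_one
      by (auto simp: hom_def units_of_def Units_def ring_mat_simps)
  next
    assume r: ?r
    have "\<rho> g \<in> Units ?M" if g: "g \<in> carrier G" for g
    proof -
      have "\<rho> (inv\<^bsub>G\<^esub> g) * \<rho> g = 1\<^sub>m n" "\<rho> g * \<rho> (inv\<^bsub>G\<^esub> g) = 1\<^sub>m n"
        using r g by (metis G.inv_closed G.l_inv, metis G.inv_closed G.r_inv)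
      then show ?thesis
        using r g by (auto simp: Units_def ring_mat_simps)
    qed
    then show ?l
      using r by (auto simp: representation_def hom_def units_of_def ring_mat_simps)
  qed
qed

lemma representation_closed:
  "representation G n \<rho> \<Longrightarrow> g \<in> carrier G \<Longrightarrow> \<rho> g \<in> carrier_mat n n"
  by (auto simp: representation_def hom_def units_of_def Units_def ring_mat_simps)

lemma representation_mult:
  "representation G n \<rho> \<Longrightarrow> g \<in> carrier G \<Longrightarrow> h \<in> carrier G \<Longrightarrow> \<rho> (g \<otimes>\<^bsub>G\<^esub> h) = \<rho> g * \<rho> h"
  by (auto simp: representation_def hom_def units_of_def ring_mat_simps)

lemma representation_one:
  "group G \<Longrightarrow> representation G n \<rho> \<Longrightarrow> \<rho> \<one>\<^bsub>G\<^esub> = 1\<^sub>m n"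
  by (simp add: representation_iff)

lemma character_one:
  "group G \<Longrightarrow> representation G n \<rho> \<Longrightarrow> character \<rho> \<one>\<^bsub>G\<^esub> = of_nat n"
  by (simp add: character_eq_tr representation_one)

lemma irreducible_rep_representation: "irreducible_rep G n \<rho> \<Longrightarrow> representation G n \<rho>"
  by (simp add: irreducible_rep_def)

section \<open>Schur's lemma\<close>

lemma subspace_carrier_vecI:
  assumes "W \<subseteq> carrier_vec n" "0\<^sub>v n \<in> W"
    "\<And>v w. v \<in> W \<Longrightarrow> w \<in> W \<Longrightarrow> v + w \<in> W"
    "\<And>c v. v \<in> W \<Longrightarrow> c \<cdot>\<^sub>v v \<in> W"
  shows "VectorSpace.subspace class_ring W (module_vec TYPE(complex) n)"
  using assms vec_module[of n, where 'a = complex]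
  by (auto simp: VectorSpace.subspace_def submodule_def vec_vs module_vec_simps class_ring_simps)

lemma mult_unit_vec_eq_col:
  "A \<in> carrier_mat m n \<Longrightarrow> j < n \<Longrightarrow> A *\<^sub>v unit_vec n j = col A j" for A :: "'b :: comm_ring_1 mat"
  by (intro eq_vecI) auto

text \<open>The kernel and the image of an intertwiner are invariant subspaces. By irreducibility a
  nonzero intertwiner has zero kernel and full image, so it is invertible.\<close>

lemma schur_intertwiner:
  assumes \<rho>: "irreducible_rep G n \<rho>" and \<sigma>: "irreducible_rep G m \<sigma>"
    and P: "P \<in> carrier_mat m n"
    and comm: "\<And>g. g \<in> carrier G \<Longrightarrow> P * \<rho> g = \<sigma> g * P"
  shows "P = 0\<^sub>m m n \<or> (m = n \<and> P \<in> Units (ring_mat TYPE(complex) n ()))"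
proof (cases "P = 0\<^sub>m m n")
  case False
  note r = representation_closed[OF irreducible_rep_representation[OF \<rho>]]
    representation_closed[OF irreducible_rep_representation[OF \<sigma>]]
  define K where "K = {v \<in> carrier_vec n. P *\<^sub>v v = 0\<^sub>v m}"
  define I where "I = (*\<^sub>v) P ` carrier_vec n"
  have "VectorSpace.subspace class_ring K (module_vec TYPE(complex) n)"
    using P by (intro subspace_carrier_vecI)
      (auto simp: K_def mult_add_distrib_mat_vec mult_mat_vec)
  moreover have "\<rho> g *\<^sub>v v \<in> K" if "g \<in> carrier G" "v \<in> K" for g v
  proof -
    have "P *\<^sub>v (\<rho> g *\<^sub>v v) = (P * \<rho> g) *\<^sub>v v"
      using that P r(1)[OF that(1)] by (simp add: K_def)
    also have "\<dots> = \<sigma> g *\<^sub>v (P *\<^sub>v v)"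
      using that P r(2)[OF that(1)] by (simp add: comm K_def)
    also have "\<dots> = 0\<^sub>v m" using that r(2)[OF that(1)] by (auto simp: K_def)
    finally show ?thesis using that r(1)[OF that(1)] by (auto simp: K_def)
  qed
  ultimately have K: "K = {0\<^sub>v n} \<or> K = carrier_vec n"
    using \<rho> unfolding irreducible_rep_def by blast
  have "VectorSpace.subspace class_ring I (module_vec TYPE(complex) m)"
  proof (rule subspace_carrier_vecI)
    show "I \<subseteq> carrier_vec m" using P by (auto simp: I_def)
    show "0\<^sub>v m \<in> I" using P by (auto simp: I_def intro!: image_eqI[of _ _ "0\<^sub>v n"])
    show "v + w \<in> I" if vw: "v \<in> I" "w \<in> I" for v w
    proof -
      obtain v' w' where "v' \<in> carrier_vec n" "w' \<in> carrier_vec n" "v = P *\<^sub>v v'" "w = P *\<^sub>v w'"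
        using vw by (auto simp: I_def)
      then show ?thesis
        using P by (auto simp: I_def mult_add_distrib_mat_vec intro!: image_eqI[of _ _ "v' + w'"])
    qed
    show "c \<cdot>\<^sub>v v \<in> I" if v: "v \<in> I" for c v
    proof -
      obtain v' where "v' \<in> carrier_vec n" "v = P *\<^sub>v v'"
        using v by (auto simp: I_def)
      then show ?thesis
        using P by (auto simp: I_def mult_mat_vec intro!: image_eqI[of _ _ "c \<cdot>\<^sub>v v'"])
    qed
  qed
  moreover have "\<sigma> g *\<^sub>v w \<in> I" if "g \<in> carrier G" and w: "w \<in> I" for g w
  proof -
    obtain v where v: "v \<in> carrier_vec n" "w = P *\<^sub>v v" using w by (auto simp: I_def)
    have "\<sigma> g *\<^sub>v w = (\<sigma> g * P) *\<^sub>v v"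
      using v P r(2)[OF that(1)] by auto
    also have "\<dots> = P *\<^sub>v (\<rho> g *\<^sub>v v)"
      using v P r(1)[OF that(1)] by (auto simp: comm[OF that(1), symmetric])
    finally show ?thesis using v r(1)[OF that(1)] by (auto simp: I_def)
  qed
  ultimately have I: "I = {0\<^sub>v m} \<or> I = carrier_vec m"
    using \<sigma> unfolding irreducible_rep_def by blast
  \<comment> \<open>A matrix that kills every unit vector has zero columns. A vector with nonzero
    image rules out both \<open>K = carrier_vec n\<close> and
    \<open>I = {0\<^sub>v m}\<close>.\<close>
  have nz: "\<exists>v\<in>carrier_vec n. P *\<^sub>v v \<noteq> 0\<^sub>v m"
  proof (rule ccontr)
    assume "\<not> ?thesis"
    then have z: "P *\<^sub>v v = 0\<^sub>v m" if "v \<in> carrier_vec n" for v using that by blast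
    have "P = 0\<^sub>m m n"
    proof (rule eq_matI)
      fix i j assume ij: "i < dim_row (0\<^sub>m m n)" "j < dim_col (0\<^sub>m m n)"
      have "col P j = P *\<^sub>v unit_vec n j"
        using ij P by (simp add: mult_unit_vec_eq_col)
      also have "\<dots> = 0\<^sub>v m" by (rule z) simp
      finally show "P $$ (i, j) = 0\<^sub>m m n $$ (i, j)"
        using ij P by (metis carrier_matD index_col index_zero_mat index_zero_vec(1))
    qed (use P in auto)
    then show False using False by simp
  qed
  have K0: "K = {0\<^sub>v n}"
    using K nz by (auto simp: K_def)
  have Iall: "I = carrier_vec m"
    using I nz by (auto simp: I_def)
  \<comment> \<open>By surjectivity every unit vector has a preimage; taken as columns, these
    preimages form a right inverse \<open>Y\<close> of \<open>P\<close>.\<close>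
  have "\<forall>i. \<exists>v. i < m \<longrightarrow> v \<in> carrier_vec n \<and> P *\<^sub>v v = unit_vec m i"
    using Iall unfolding I_def by (metis imageE unit_vec_carrier)
  then obtain y where y: "\<And>i. i < m \<Longrightarrow> y i \<in> carrier_vec n" "\<And>i. i < m \<Longrightarrow> P *\<^sub>v y i = unit_vec m i"
    by metis
  define Y where "Y = mat_of_cols n (map y [0..<m])"
  have Y: "Y \<in> carrier_mat n m"
    using mat_of_cols_carrier(1)[of n "map y [0..<m]"] by (simp add: Y_def)
  have colY: "col Y i = y i" if "i < m" for i
    using that y by (simp add: Y_def)
  have PY: "P * Y = 1\<^sub>m m"
  proof (rule eq_matI)
    fix i j assume ij: "i < dim_row (1\<^sub>m m)" "j < dim_col (1\<^sub>m m)"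
    have "(P * Y) $$ (i, j) = (P *\<^sub>v y j) $ i"
      using ij P Y colY by auto
    then show "(P * Y) $$ (i, j) = 1\<^sub>m m $$ (i, j)"
      using ij y by simp
  qed (use P Y in auto)
  have YP: "Y * P = 1\<^sub>m n"
  proof (rule eq_matI)
    fix i j assume ij: "i < dim_row (1\<^sub>m n)" "j < dim_col (1\<^sub>m n)"
    let ?e = "unit_vec n j :: complex vec"
    \<comment> \<open>\<open>P\<close> sends \<open>Y P e\<close> and \<open>e\<close> to the same
      vector, so their difference lies in the kernel and injectivity makes it zero. Hence
      \<open>Y\<close> is a left inverse too.\<close>
    define v where "v = Y *\<^sub>v (P *\<^sub>v ?e) - ?e"
    have c: "Y *\<^sub>v (P *\<^sub>v ?e) \<in> carrier_vec n" "P *\<^sub>v ?e \<in> carrier_vec m" using P Y by auto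
    have "P *\<^sub>v v = P *\<^sub>v (Y *\<^sub>v (P *\<^sub>v ?e)) - P *\<^sub>v ?e"
      unfolding v_def using P c by (intro mult_minus_distrib_mat_vec) auto
    also have "P *\<^sub>v (Y *\<^sub>v (P *\<^sub>v ?e)) = (P * Y) *\<^sub>v (P *\<^sub>v ?e)"
      using P Y by (intro assoc_mult_mat_vec[symmetric]) auto
    also have "\<dots> = P *\<^sub>v ?e" using c by (simp add: PY)
    finally have "v \<in> K" using c by (auto simp: K_def v_def)
    then have "v = 0\<^sub>v n" by (simp add: K0)
    then have "v $ i = 0" using ij by simp
    then have "(Y *\<^sub>v (P *\<^sub>v ?e)) $ i = ?e $ i"
      using ij c by (simp add: v_def)
    also have "Y *\<^sub>v (P *\<^sub>v ?e) = (Y * P) *\<^sub>v ?e"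
      using P Y by (intro assoc_mult_mat_vec[symmetric]) auto
    also have "(Y * P) *\<^sub>v ?e = col (Y * P) j" 
      using ij P Y by (intro mult_unit_vec_eq_col) auto
    finally show "(Y * P) $$ (i, j) = 1\<^sub>m n $$ (i, j)"
      using ij P Y by auto
  qed (use P Y in auto)
  \<comment> \<open>Two-sided inverses of an \<open>m \<times> n\<close> matrix force \<open>m = n\<close> by comparing traces.\<close>
  have "(of_nat m :: complex) = of_nat n"
    using tr_comm[OF P Y] by (simp add: PY YP)
  then have "m = n" by simp
  then show ?thesis
    using P Y PY YP by (auto simp: Units_def ring_mat_simps)
qed simp

text \<open>Over the complex numbers \<open>P\<close> has an eigenvalue \<open>c\<close>. The matrix
  \<open>P - c\<close> is again an intertwiner and is singular, so \<open>schur_intertwiner\<close>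
  leaves only the value zero.\<close>

lemma schur_scalar:
  assumes \<rho>: "irreducible_rep G n \<rho>" and P: "P \<in> carrier_mat n n"
    and comm: "\<And>g. g \<in> carrier G \<Longrightarrow> P * \<rho> g = \<rho> g * P"
  obtains c where "P = c \<cdot>\<^sub>m 1\<^sub>m n"
proof -
  have "n > 0" using \<rho> by (simp add: irreducible_rep_def)
  then obtain c where "eigenvalue P c"
    using spectrum_non_empty[OF P] by (auto simp: spectrum_def)
  moreover have "P + (- c) \<cdot>\<^sub>m 1\<^sub>m n = P - c \<cdot>\<^sub>m 1\<^sub>m n"
    using P by (intro eq_matI) auto
  ultimately have d: "det (P - c \<cdot>\<^sub>m 1\<^sub>m n) = 0"
    using P eigenvalue_det[OF P, of c] by (simp add: char_matrix_def)
  have "P - c \<cdot>\<^sub>m 1\<^sub>m n = 0\<^sub>m n n \<or>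
      (n = n \<and> P - c \<cdot>\<^sub>m 1\<^sub>m n \<in> Units (ring_mat TYPE(complex) n ()))"
  proof (rule schur_intertwiner[OF \<rho> \<rho>])
    fix g assume g: "g \<in> carrier G"
    note r = representation_closed[OF irreducible_rep_representation[OF \<rho>] g]
    have "(P - c \<cdot>\<^sub>m 1\<^sub>m n) * \<rho> g = P * \<rho> g - c \<cdot>\<^sub>m 1\<^sub>m n * \<rho> g"
      by (rule minus_mult_distrib_mat[OF P _ r]) simp
    also have "c \<cdot>\<^sub>m 1\<^sub>m n * \<rho> g = c \<cdot>\<^sub>m \<rho> g"
      using r by (simp add: mult_smult_assoc_mat[OF one_carrier_mat r])
    also have "P * \<rho> g = \<rho> g * P" by (rule comm[OF g])
    also have "c \<cdot>\<^sub>m \<rho> g = \<rho> g * (c \<cdot>\<^sub>m 1\<^sub>m n)"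
      using r by (simp add: mult_smult_distrib[OF r one_carrier_mat])
    also have "\<rho> g * P - \<rho> g * (c \<cdot>\<^sub>m 1\<^sub>m n) = \<rho> g * (P - c \<cdot>\<^sub>m 1\<^sub>m n)"
      by (rule mult_minus_distrib_mat[OF r P, symmetric]) simp
    finally show "(P - c \<cdot>\<^sub>m 1\<^sub>m n) * \<rho> g = \<rho> g * (P - c \<cdot>\<^sub>m 1\<^sub>m n)" .
  qed (use P in auto)
  with d have z: "P - c \<cdot>\<^sub>m 1\<^sub>m n = 0\<^sub>m n n"
    by (auto dest: unit_imp_det_non_zero)
  have "P = c \<cdot>\<^sub>m 1\<^sub>m n"
  proof (rule eq_matI)
    fix i j assume "i < dim_row (c \<cdot>\<^sub>m 1\<^sub>m n)" "j < dim_col (c \<cdot>\<^sub>m 1\<^sub>m n)"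
    then show "P $$ (i, j) = (c \<cdot>\<^sub>m 1\<^sub>m n) $$ (i, j)"
      using arg_cong[OF z, of "\<lambda>A. A $$ (i, j)"] P by simp
  qed (use P in auto)
  then show ?thesis by (rule that)
qed

section \<open>Averaging and row orthogonality\<close>

text \<open>The dimensions are arguments because the type \<open>complex mat\<close> has no zero, so \<open>sum\<close> is not
  available on it.\<close>

definition msum :: "nat \<Rightarrow> nat \<Rightarrow> ('b \<Rightarrow> complex mat) \<Rightarrow> 'b set \<Rightarrow> complex mat" where
  "msum n m f S = mat n m (\<lambda>ij. \<Sum>g\<in>S. f g $$ ij)"

lemma msum_carrier [simp]: "msum n m f S \<in> carrier_mat n m"
  by (simp add: msum_def)

lemma mult_msum:
  assumes "A \<in> carrier_mat l n" "\<And>g. g \<in> S \<Longrightarrow> f g \<in> carrier_mat n m"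
  shows "A * msum n m f S = msum l m (\<lambda>g. A * f g) S"
proof (rule eq_matI)
  fix i j assume ij: "i < dim_row (msum l m (\<lambda>g. A * f g) S)" "j < dim_col (msum l m (\<lambda>g. A * f g) S)"
  have "(A * msum n m f S) $$ (i, j) = (\<Sum>k<n. \<Sum>g\<in>S. A $$ (i, k) * f g $$ (k, j))"
    using assms(1) ij by (auto simp: msum_def scalar_prod_def atLeast0LessThan sum_distrib_left intro!: sum.cong)
  also have "\<dots> = (\<Sum>g\<in>S. \<Sum>k<n. A $$ (i, k) * f g $$ (k, j))"
    by (rule sum.swap)
  also have "\<dots> = (\<Sum>g\<in>S. (A * f g) $$ (i, j))"
  proof (rule sum.cong)
    fix g assume "g \<in> S"
    from assms(2)[OF this] assms(1) ij
    show "(\<Sum>k<n. A $$ (i, k) * f g $$ (k, j)) = (A * f g) $$ (i, j)"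
      by (auto simp: msum_def scalar_prod_def atLeast0LessThan intro!: sum.cong)
  qed simp
  finally show "(A * msum n m f S) $$ (i, j) = msum l m (\<lambda>g. A * f g) S $$ (i, j)"
    using ij by (simp add: msum_def)
qed (use assms in \<open>auto simp: msum_def\<close>)

lemma msum_mult:
  assumes "A \<in> carrier_mat m l" "\<And>g. g \<in> S \<Longrightarrow> f g \<in> carrier_mat n m"
  shows "msum n m f S * A = msum n l (\<lambda>g. f g * A) S"
proof (rule eq_matI)
  fix i j assume ij: "i < dim_row (msum n l (\<lambda>g. f g * A) S)" "j < dim_col (msum n l (\<lambda>g. f g * A) S)"
  have "(msum n m f S * A) $$ (i, j) = (\<Sum>k<m. \<Sum>g\<in>S. f g $$ (i, k) * A $$ (k, j))"
    using assms(1) ij by (auto simp: msum_def scalar_prod_def atLeast0LessThan sum_distrib_right intro!: sum.cong)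
  also have "\<dots> = (\<Sum>g\<in>S. \<Sum>k<m. f g $$ (i, k) * A $$ (k, j))"
    by (rule sum.swap)
  also have "\<dots> = (\<Sum>g\<in>S. (f g * A) $$ (i, j))"
  proof (rule sum.cong)
    fix g assume "g \<in> S"
    from assms(2)[OF this] assms(1) ij
    show "(\<Sum>k<m. f g $$ (i, k) * A $$ (k, j)) = (f g * A) $$ (i, j)"
      by (auto simp: msum_def scalar_prod_def atLeast0LessThan intro!: sum.cong)
  qed simp
  finally show "(msum n m f S * A) $$ (i, j) = msum n l (\<lambda>g. f g * A) S $$ (i, j)"
    using ij by (simp add: msum_def)
qed (use assms in \<open>auto simp: msum_def\<close>)

lemma tr_msum:
  assumes "\<And>g. g \<in> S \<Longrightarrow> f g \<in> carrier_mat n n"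
  shows "tr (msum n n f S) = (\<Sum>g\<in>S. tr (f g))"
proof -
  have "(\<Sum>g\<in>S. tr (f g)) = (\<Sum>g\<in>S. \<Sum>i<n. f g $$ (i, i))"
    using assms by (intro sum.cong) (auto simp: tr_def)
  also have "\<dots> = (\<Sum>i<n. \<Sum>g\<in>S. f g $$ (i, i))" by (rule sum.swap)
  finally show ?thesis by (simp add: tr_def msum_def)
qed

lemma msum_reindex:
  assumes "bij_betw p T S"
  shows "msum n m f S = msum n m (\<lambda>t. f (p t)) T"
  unfolding msum_def by (simp add: sum.reindex_bij_betw[OF assms, symmetric])

lemma msum_cong:
  "(\<And>g. g \<in> S \<Longrightarrow> f g = f' g) \<Longrightarrow> msum n m f S = msum n m f' S"
  by (simp add: msum_def)

text \<open>Averaging over the group, without the factor 1/|G|: it turns an arbitrary matrix into an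
  intertwiner from \<rho> to \<sigma>.\<close>

definition avg :: "'a monoid \<Rightarrow> nat \<Rightarrow> 'a rep \<Rightarrow> nat \<Rightarrow> 'a rep \<Rightarrow> complex mat \<Rightarrow> complex mat" where
  "avg G m \<sigma> n \<rho> A = msum m n (\<lambda>g. \<sigma> g * A * \<rho> (inv\<^bsub>G\<^esub> g)) (carrier G)"

lemma avg_carrier [simp]: "avg G m \<sigma> n \<rho> A \<in> carrier_mat m n"
  by (simp add: avg_def)

text \<open>Replacing the summation variable \<open>g\<close> by \<open>h g\<close> brings out
  \<open>\<sigma> h\<close> on the left, while on the right
  \<open>\<rho> (inv (h g)) * \<rho> h\<close> collapses to \<open>\<rho> (inv g)\<close>.\<close>

lemma avg_intertwines:
  assumes G: "group G" and \<rho>: "representation G n \<rho>" and \<sigma>: "representation G m \<sigma>"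
    and A: "A \<in> carrier_mat m n" and h: "h \<in> carrier G"
  shows "avg G m \<sigma> n \<rho> A * \<rho> h = \<sigma> h * avg G m \<sigma> n \<rho> A"
proof -
  interpret group G by fact
  note c = representation_closed[OF \<rho>] representation_closed[OF \<sigma>]
  have "avg G m \<sigma> n \<rho> A * \<rho> h = msum m n (\<lambda>g. \<sigma> g * A * \<rho> (inv\<^bsub>G\<^esub> g) * \<rho> h) (carrier G)"
    unfolding avg_def using h by (intro msum_mult mult_carrier_mat[of _ m n] mult_carrier_mat[of _ m m] c A) auto
  also have "\<dots> = msum m n (\<lambda>g. \<sigma> (h \<otimes>\<^bsub>G\<^esub> g) * A * \<rho> (inv\<^bsub>G\<^esub> (h \<otimes>\<^bsub>G\<^esub> g)) * \<rho> h) (carrier G)"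
    by (rule msum_reindex, rule bij_betwI[where g = "\<lambda>g. inv\<^bsub>G\<^esub> h \<otimes>\<^bsub>G\<^esub> g"])
      (use h in \<open>auto simp: m_assoc[symmetric]\<close>)
  also have "\<dots> = msum m n (\<lambda>g. \<sigma> h * (\<sigma> g * A * \<rho> (inv\<^bsub>G\<^esub> g))) (carrier G)"
  proof (rule msum_cong)
    fix g assume g: "g \<in> carrier G"
    note cc = c(1)[OF h] c(1)[OF inv_closed[OF g]] c(1)[OF inv_closed[OF h]] c(2)[OF g] c(2)[OF h] A
    have "\<rho> (inv\<^bsub>G\<^esub> (h \<otimes>\<^bsub>G\<^esub> g)) * \<rho> h = \<rho> (inv\<^bsub>G\<^esub> (h \<otimes>\<^bsub>G\<^esub> g) \<otimes>\<^bsub>G\<^esub> h)"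
      using g h by (simp add: representation_mult[OF \<rho>])
    also have "inv\<^bsub>G\<^esub> (h \<otimes>\<^bsub>G\<^esub> g) \<otimes>\<^bsub>G\<^esub> h = inv\<^bsub>G\<^esub> g"
      using g h by (simp add: inv_mult_group m_assoc)
    finally have *: "\<rho> (inv\<^bsub>G\<^esub> (h \<otimes>\<^bsub>G\<^esub> g)) * \<rho> h = \<rho> (inv\<^bsub>G\<^esub> g)" .
    have "\<sigma> (h \<otimes>\<^bsub>G\<^esub> g) * A * \<rho> (inv\<^bsub>G\<^esub> (h \<otimes>\<^bsub>G\<^esub> g)) * \<rho> h
        = \<sigma> (h \<otimes>\<^bsub>G\<^esub> g) * A * (\<rho> (inv\<^bsub>G\<^esub> (h \<otimes>\<^bsub>G\<^esub> g)) * \<rho> h)"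
      by (rule assoc_mult_mat[of _ m n _ n _ n])
        (use g h in \<open>auto intro!: c A mult_carrier_mat[of _ m m]\<close>)
    also have "\<dots> = \<sigma> h * \<sigma> g * A * \<rho> (inv\<^bsub>G\<^esub> g)"
      using g h by (simp add: * representation_mult[OF \<sigma>])
    also have "\<dots> = \<sigma> h * (\<sigma> g * A * \<rho> (inv\<^bsub>G\<^esub> g))"
      using cc by (simp add: assoc_mult_mat[of _ m m _ n _ n] assoc_mult_mat[of _ m m _ m _ n])
    finally show "\<sigma> (h \<otimes>\<^bsub>G\<^esub> g) * A * \<rho> (inv\<^bsub>G\<^esub> (h \<otimes>\<^bsub>G\<^esub> g)) * \<rho> h
        = \<sigma> h * (\<sigma> g * A * \<rho> (inv\<^bsub>G\<^esub> g))" .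
  qed
  also have "\<dots> = \<sigma> h * avg G m \<sigma> n \<rho> A"
    unfolding avg_def using h by (intro mult_msum[symmetric] mult_carrier_mat[of _ m n] mult_carrier_mat[of _ m m] c A) auto
  finally show ?thesis .
qed

text \<open>By Schur's lemma the average is a scalar matrix, and its trace determines the scalar:
  each of the |G| summands is a conjugate of \<open>A\<close> and has the trace of
  \<open>A\<close>.\<close>

lemma avg_irreducible:
  assumes G: "group G" and \<rho>: "irreducible_rep G n \<rho>" and A: "A \<in> carrier_mat n n"
  shows "avg G n \<rho> n \<rho> A = (of_nat (card (carrier G)) * tr A / of_nat n) \<cdot>\<^sub>m 1\<^sub>m n"
proof -
  interpret group G by fact
  note r = irreducible_rep_representation[OF \<rho>]
  note c = representation_closed[OF r]
  obtain z where z: "avg G n \<rho> n \<rho> A = z \<cdot>\<^sub>m 1\<^sub>m n"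
    by (rule schur_scalar[OF \<rho>, of "avg G n \<rho> n \<rho> A"]) (auto intro: avg_intertwines[OF G r r A])
  have "z * of_nat n = tr (avg G n \<rho> n \<rho> A)"
    by (simp add: z tr_smult[OF one_carrier_mat])
  also have "\<dots> = (\<Sum>g\<in>carrier G. tr (\<rho> g * A * \<rho> (inv\<^bsub>G\<^esub> g)))"
    unfolding avg_def by (intro tr_msum mult_carrier_mat[of _ n n] c A) auto
  also have "\<dots> = (\<Sum>g\<in>carrier G. tr A)"
  proof (rule sum.cong)
    fix g assume g: "g \<in> carrier G"
    have "tr (\<rho> g * A * \<rho> (inv\<^bsub>G\<^esub> g)) = tr (\<rho> (inv\<^bsub>G\<^esub> g) * (\<rho> g * A))"
      using c[OF g] c[OF inv_closed[OF g]] A by (intro tr_comm) auto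
    also have "\<rho> (inv\<^bsub>G\<^esub> g) * (\<rho> g * A) = \<rho> (inv\<^bsub>G\<^esub> g) * \<rho> g * A"
      using c[OF g] c[OF inv_closed[OF g]] A by (intro assoc_mult_mat[symmetric]) auto
    also have "\<rho> (inv\<^bsub>G\<^esub> g) * \<rho> g = 1\<^sub>m n"
      using g by (simp add: representation_mult[OF r, symmetric] representation_one[OF G r])
    finally show "tr (\<rho> g * A * \<rho> (inv\<^bsub>G\<^esub> g)) = tr A" using A by simp
  qed simp
  also have "\<dots> = of_nat (card (carrier G)) * tr A" by simp
  finally have "z = of_nat (card (carrier G)) * tr A / of_nat n"
    using \<rho> by (simp add: irreducible_rep_def field_simps)
  then show ?thesis by (simp add: z)
qed

section \<open>Matrix units and row orthogonality\<close>

definition mat_unit :: "nat \<Rightarrow> nat \<Rightarrow> nat \<Rightarrow> nat \<Rightarrow> complex mat" where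
  "mat_unit m n k l = mat m n (\<lambda>ij. if ij = (k, l) then 1 else 0)"

lemma mat_unit_carrier [simp]: "mat_unit m n k l \<in> carrier_mat m n"
  by (simp add: mat_unit_def)

text \<open>A matrix unit between two factors picks out one entry of each. Averages of matrix units
  thereby become sums of products of matrix coefficients.\<close>

lemma mult_mat_unit_mult:
  assumes A: "A \<in> carrier_mat l m" and B: "B \<in> carrier_mat n p" and "k < m" "k' < n" "i < l" "j < p"
  shows "(A * mat_unit m n k k' * B) $$ (i, j) = A $$ (i, k) * B $$ (k', j)"
proof -
  have "(A * mat_unit m n k k') $$ (i, t) = (if t = k' then A $$ (i, k) else 0)" if "t < n" for t
  proof -
    have "(A * mat_unit m n k k') $$ (i, t) = (\<Sum>s<m. A $$ (i, s) * (if (s, t) = (k, k') then 1 else 0))"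
      using assms that by (auto simp: mat_unit_def scalar_prod_def atLeast0LessThan intro!: sum.cong)
    also have "\<dots> = (\<Sum>s<m. if s = k then (if t = k' then A $$ (i, k) else 0) else 0)"
      by (intro sum.cong) auto
    finally show ?thesis using \<open>k < m\<close> by simp
  qed
  then have "(A * mat_unit m n k k' * B) $$ (i, j)
      = (\<Sum>t<n. (if t = k' then A $$ (i, k) else 0) * B $$ (t, j))"
    using assms mat_unit_carrier[of m n k k']
    by (auto simp: scalar_prod_def atLeast0LessThan mat_unit_def intro!: sum.cong)
  also have "\<dots> = (\<Sum>t<n. if t = k' then A $$ (i, k) * B $$ (k', j) else 0)"
    by (intro sum.cong) auto
  finally show ?thesis using \<open>k' < n\<close> by simp
qed

lemma tr_mat_unit: "k < n \<Longrightarrow> tr (mat_unit n n k l) = (if k = l then 1 else 0)"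
  by (simp add: tr_def mat_unit_def if_distrib[of "\<lambda>x. x = _"] sum.delta cong: if_cong)

text \<open>The entry at \<open>(k, i)\<close> of the averaged matrix unit is the sum over the group
  of \<open>\<sigma> g $$ (k, k) * \<rho> (inv g) $$ (i, i)\<close>. Summing over both indices
  multiplies the two traces.\<close>

lemma character_sum_avg:
  assumes G: "group G" and \<rho>: "representation G n \<rho>" and \<sigma>: "representation G m \<sigma>"
  shows "(\<Sum>g\<in>carrier G. character \<rho> (inv\<^bsub>G\<^esub> g) * character \<sigma> g)
    = (\<Sum>k<m. \<Sum>i<n. avg G m \<sigma> n \<rho> (mat_unit m n k i) $$ (k, i))"
proof -
  interpret group G by fact
  note c = representation_closed[OF \<rho>] representation_closed[OF \<sigma>]
  have "(\<Sum>k<m. \<Sum>i<n. avg G m \<sigma> n \<rho> (mat_unit m n k i) $$ (k, i))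
      = (\<Sum>k<m. \<Sum>i<n. \<Sum>g\<in>carrier G. \<sigma> g $$ (k, k) * \<rho> (inv\<^bsub>G\<^esub> g) $$ (i, i))"
    using c by (intro sum.cong refl)
      (simp add: avg_def msum_def mult_mat_unit_mult[of _ m m _ n n])
  also have "\<dots> = (\<Sum>g\<in>carrier G. \<Sum>k<m. \<Sum>i<n. \<sigma> g $$ (k, k) * \<rho> (inv\<^bsub>G\<^esub> g) $$ (i, i))"
    by (simp add: sum.swap[where B = "carrier G"])
  also have "\<dots> = (\<Sum>g\<in>carrier G. character \<rho> (inv\<^bsub>G\<^esub> g) * character \<sigma> g)"
  proof (rule sum.cong[OF refl])
    fix g assume g: "g \<in> carrier G"
    have "dim_row (\<sigma> g) = m" "dim_row (\<rho> (inv\<^bsub>G\<^esub> g)) = n"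
      using c(2)[OF g] c(1)[OF inv_closed[OF g]] by auto
    then have "character \<sigma> g * character \<rho> (inv\<^bsub>G\<^esub> g)
        = (\<Sum>k<m. \<Sum>i<n. \<sigma> g $$ (k, k) * \<rho> (inv\<^bsub>G\<^esub> g) $$ (i, i))"
      by (simp add: character_def sum_product)
    then show "(\<Sum>k<m. \<Sum>i<n. \<sigma> g $$ (k, k) * \<rho> (inv\<^bsub>G\<^esub> g) $$ (i, i))
        = character \<rho> (inv\<^bsub>G\<^esub> g) * character \<sigma> g"
      by (simp add: mult.commute)
  qed
  finally show ?thesis ..
qed

text \<open>An invertible intertwiner makes \<open>\<rho> g\<close> and \<open>\<sigma> g\<close>
  conjugate matrices, and the trace is invariant under conjugation.\<close>

lemma character_rep_iso:
  assumes "rep_iso G \<rho> \<sigma>" "g \<in> carrier G"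
  shows "character \<rho> g = character \<sigma> g"
proof -
  obtain n P where r: "representation G n \<rho>" "representation G n \<sigma>"
    and P: "P \<in> Units (ring_mat TYPE(complex) n ())" "P * \<rho> g = \<sigma> g * P"
    using assms by (auto simp: rep_iso_def)
  then obtain P' where P': "P' \<in> carrier_mat n n" "P \<in> carrier_mat n n" "P' * P = 1\<^sub>m n" "P * P' = 1\<^sub>m n"
    by (auto simp: Units_def ring_mat_simps)
  note c = representation_closed[OF r(1) assms(2)] representation_closed[OF r(2) assms(2)] 
  have "tr (\<sigma> g) = tr (\<sigma> g * (P * P'))" using c P' by simp
  also have "\<sigma> g * (P * P') = P * \<rho> g * P'"
    unfolding P(2) using c P' by (intro assoc_mult_mat[symmetric]) auto
  also have "tr (P * \<rho> g * P') = tr (P' * (P * \<rho> g))"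
    using c P' by (intro tr_comm) auto
  also have "P' * (P * \<rho> g) = P' * P * \<rho> g"
    using c P' by (intro assoc_mult_mat[symmetric]) auto
  also have "\<dots> = \<rho> g" using c P' by simp
  finally show ?thesis by (simp add: character_eq_tr)
qed

text \<open>Both cases evaluate the averages in \<open>character_sum_avg\<close> by Schur's lemma,
  which gives scalars for isomorphic representations and zero otherwise.\<close>

lemma row_orthogonality:
  assumes G: "group G" and \<rho>: "irreducible_rep G n \<rho>" and \<sigma>: "irreducible_rep G m \<sigma>"
  shows "(\<Sum>g\<in>carrier G. character \<rho> (inv\<^bsub>G\<^esub> g) * character \<sigma> g)
    = (if rep_iso G \<rho> \<sigma> then of_nat (card (carrier G)) else 0)"
proof -
  interpret group G by fact
  note r = irreducible_rep_representation[OF \<rho>] irreducible_rep_representation[OF \<sigma>]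
  show ?thesis
  proof (cases "rep_iso G \<rho> \<sigma>")
    case True
    have "(\<Sum>g\<in>carrier G. character \<rho> (inv\<^bsub>G\<^esub> g) * character \<sigma> g)
        = (\<Sum>g\<in>carrier G. character \<rho> (inv\<^bsub>G\<^esub> g) * character \<rho> g)"
      using character_rep_iso[OF True] by simp
    also have "\<dots> = (\<Sum>k<n. \<Sum>i<n. avg G n \<rho> n \<rho> (mat_unit n n k i) $$ (k, i))"
      by (rule character_sum_avg[OF G r(1) r(1)])
    \<comment> \<open>The scalar is governed by the trace of the matrix unit, which is 1 for
      \<open>k = i\<close> and 0 otherwise; the \<open>n\<close> diagonal terms contribute |G|/n
      each.\<close>
    also have "\<dots> = (\<Sum>k<n. \<Sum>i<n. if k = i then of_nat (card (carrier G)) / of_nat n else 0)"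
      by (intro sum.cong refl) (auto simp: avg_irreducible[OF G \<rho>] tr_mat_unit)
    also have "\<dots> = of_nat (card (carrier G))"
      using \<rho> by (simp add: irreducible_rep_def)
    finally show ?thesis using True by simp
  next
    case False
    have "avg G m \<sigma> n \<rho> A = 0\<^sub>m m n" if A: "A \<in> carrier_mat m n" for A
    proof -
      have "avg G m \<sigma> n \<rho> A = 0\<^sub>m m n \<or>
          (m = n \<and> avg G m \<sigma> n \<rho> A \<in> Units (ring_mat TYPE(complex) n ()))"
        using avg_intertwines[OF G r A] by (intro schur_intertwiner[OF \<rho> \<sigma>]) auto
      \<comment> \<open>An invertible average would itself be an isomorphism, contrary to the case
        assumption.\<close>
      moreover have "rep_iso G \<rho> \<sigma>"
        if "m = n" "avg G m \<sigma> n \<rho> A \<in> Units (ring_mat TYPE(complex) n ())"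
        using that r avg_intertwines[OF G r A] unfolding rep_iso_def by blast
      ultimately show ?thesis using False by blast
    qed
    then show ?thesis
      using False by (simp add: character_sum_avg[OF G r])
  qed
qed

text \<open>The matrices \<open>\<rho> (h y h\<^sup>-\<^sup>1)\<close> sum to \<open>avg\<close> of
  \<open>\<rho> y\<close>, a scalar matrix. Multiplying by \<open>\<rho> x\<close> and taking traces
  separates the two characters; the factor \<open>n\<close> clears the denominator of the
  scalar.\<close>

lemma character_sum_conjugates:
  assumes G: "group G" and \<rho>: "irreducible_rep G n \<rho>" and x: "x \<in> carrier G" and y: "y \<in> carrier G"
  shows "of_nat n * (\<Sum>h\<in>carrier G. character \<rho> (x \<otimes>\<^bsub>G\<^esub> (h \<otimes>\<^bsub>G\<^esub> y \<otimes>\<^bsub>G\<^esub> inv\<^bsub>G\<^esub> h)))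
    = of_nat (card (carrier G)) * character \<rho> x * character \<rho> y"
proof -
  interpret group G by fact
  note r = irreducible_rep_representation[OF \<rho>]
  note c = representation_closed[OF r]
  let ?c = "of_nat (card (carrier G)) * tr (\<rho> y) / of_nat n"
  have "(\<Sum>h\<in>carrier G. character \<rho> (x \<otimes>\<^bsub>G\<^esub> (h \<otimes>\<^bsub>G\<^esub> y \<otimes>\<^bsub>G\<^esub> inv\<^bsub>G\<^esub> h)))
      = (\<Sum>h\<in>carrier G. tr (\<rho> x * (\<rho> h * \<rho> y * \<rho> (inv\<^bsub>G\<^esub> h))))"
    using x y by (intro sum.cong refl) (simp add: character_eq_tr representation_mult[OF r])
  also have "\<dots> = tr (msum n n (\<lambda>h. \<rho> x * (\<rho> h * \<rho> y * \<rho> (inv\<^bsub>G\<^esub> h))) (carrier G))"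
    using x y by (intro tr_msum[symmetric] mult_carrier_mat[of _ n n] c) auto
  also have "msum n n (\<lambda>h. \<rho> x * (\<rho> h * \<rho> y * \<rho> (inv\<^bsub>G\<^esub> h))) (carrier G) = \<rho> x * avg G n \<rho> n \<rho> (\<rho> y)"
    unfolding avg_def using x y by (intro mult_msum[symmetric] mult_carrier_mat[of _ n n] c) auto
  also have "\<dots> = ?c \<cdot>\<^sub>m \<rho> x"
    using c[OF x] unfolding avg_irreducible[OF G \<rho> c[OF y]]
    by (simp add: mult_smult_distrib[OF c[OF x] one_carrier_mat])
  also have "tr \<dots> = ?c * tr (\<rho> x)" by (rule tr_smult[OF c[OF x]])
  finally show ?thesis
    using \<rho> by (simp add: character_eq_tr irreducible_rep_def)
qed

section \<open>Decomposition of characters\<close>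

text \<open>The columns of \<open>P\<close> are a basis of the whole space whose first
  \<open>k\<close> members are a basis of \<open>W\<close>. Its inverse \<open>P'\<close> computes
  coordinates, so on \<open>W\<close> all coordinates from \<open>k\<close> onwards vanish.\<close>

lemma exists_adapted_basis:
  assumes sub: "VectorSpace.subspace class_ring W (module_vec TYPE(complex) n)"
    and ne: "W \<noteq> {0\<^sub>v n}" "W \<noteq> carrier_vec n"
  obtains k P P' where "0 < k" "k < n" "P \<in> carrier_mat n n" "P' \<in> carrier_mat n n"
    "P * P' = 1\<^sub>m n" "P' * P = 1\<^sub>m n"
    "\<And>j. j < k \<Longrightarrow> col P j \<in> W"
    "\<And>w i. w \<in> W \<Longrightarrow> k \<le> i \<Longrightarrow> i < n \<Longrightarrow> (P' *\<^sub>v w) $ i = 0"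
proof -
  interpret vec_space "TYPE(complex)" n .
  have Wsub: "submodule class_ring W V" using sub by (simp add: VectorSpace.subspace_def)
  then have WC: "W \<subseteq> carrier_vec n" by (auto simp: submodule_def module_vec_simps)
  have bound: "finite B \<and> card B \<le> n" if "B \<subseteq> carrier_vec n" "lin_indpt B" for B
    using li_le_dim[of B] that by (simp add: dim_is_n)
  \<comment> \<open>A largest independent set between \<open>A\<close> and \<open>U\<close> spans
    \<open>U\<close>, since a vector outside its span could be added. This is applied from the empty
    set inside \<open>W\<close>, then from the resulting basis inside the whole space.\<close>
  have ex_max: "\<exists>B. A \<subseteq> B \<and> B \<subseteq> U \<and> lin_indpt B \<and> U \<subseteq> span B"
    if A: "A \<subseteq> U" "lin_indpt A" and U: "U \<subseteq> carrier_vec n" for A U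
  proof -
    let ?Q = "\<lambda>B. A \<subseteq> B \<and> B \<subseteq> U \<and> lin_indpt B"
    have "?Q A" using A by simp
    moreover have "\<forall>B. ?Q B \<longrightarrow> card B < Suc n"
    proof (intro allI impI)
      fix B assume "?Q B"
      moreover from this U have "B \<subseteq> carrier_vec n" by blast
      ultimately show "card B < Suc n" using bound[of B] by simp
    qed
    ultimately have "\<exists>B. ?Q B \<and> (\<forall>C. ?Q C \<longrightarrow> card C \<le> card B)"
      by (rule ex_has_greatest_nat[of ?Q A card "Suc n"])
    then obtain B where B: "?Q B" and mx: "\<And>C. ?Q C \<Longrightarrow> card C \<le> card B" by blast
    have "u \<in> span B" if u: "u \<in> U" for u
    proof (rule ccontr)
      assume nu: "u \<notin> span B"
      have BC: "B \<subseteq> carrier_vec n" and fB: "finite B" using B U bound by auto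
      have "u \<notin> B" using nu span_mem[of B u] BC by auto
      moreover have "lin_indpt (B \<union> {u})"
        using lin_dep_iff_in_span[of B u] B nu \<open>u \<notin> B\<close> U u BC by auto
      ultimately have "card (B \<union> {u}) \<le> card B" using B u by (intro mx) auto
      then show False using \<open>u \<notin> B\<close> fB by simp
    qed
    then show ?thesis using B by blast
  qed
  have li0: "lin_indpt {}" by (simp add: lin_dep_def)
  obtain A where A: "A \<subseteq> W" "lin_indpt A" "W \<subseteq> span A"
    using ex_max[of "{}" W] li0 WC by auto
  have AC: "A \<subseteq> carrier_vec n" using A WC by auto
  obtain B where B: "A \<subseteq> B" "B \<subseteq> carrier_vec n" "lin_indpt B" "carrier_vec n \<subseteq> span B"
    using ex_max[of A "carrier_vec n"] A AC by auto
  have fin: "finite A" "finite B" using bound A B AC by auto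
  have "basis B" using B by (auto simp: basis_def)
  then have cB: "card B = n" using dim_basis[of B] fin dim_is_n by simp
  obtain as where as: "set as = A" "distinct as" using fin finite_distinct_list by blast
  obtain bs where bs: "set bs = B - A" "distinct bs" using fin finite_distinct_list by (metis finite_Diff)
  \<comment> \<open>Listing the basis of \<open>W\<close> first is what places it in the columns
    below \<open>k\<close>.\<close>
  define vs where "vs = as @ bs"
  have vs: "set vs = B" "distinct vs"
    using as bs B(1) by (auto simp: vs_def)
  then have len: "length vs = n" using cB distinct_card[of vs] by simp
  note vs = vs len
  define k where "k = length as"
  have kA: "k = card A" using as distinct_card[of as] by (simp add: k_def)
  define P where "P = mat_of_cols n vs"
  have P: "P \<in> carrier_mat n n" using mat_of_cols_carrier(1)[of n vs] vs by (simp add: P_def)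
  have colsP: "cols P = vs" unfolding P_def using vs B by (intro cols_mat_of_cols) auto
  have "rank P = n"
    using lin_indpt_full_rank[OF P] colsP vs B by simp
  then have "det P \<noteq> 0" using det_rank_iff[OF P] by simp
  then obtain P' where P': "P' \<in> carrier_mat n n" "P * P' = 1\<^sub>m n" "P' * P = 1\<^sub>m n"
    using det_non_zero_imp_unit[OF P, of "()"] by (auto simp: Units_def ring_mat_simps)
  have colW: "col P j \<in> W" if "j < k" for j
  proof -
    have "col P j = vs ! j" using that P vs colsP by (metis cols_nth k_def vs_def carrier_matD(2) length_append trans_less_add1)
    also have "\<dots> \<in> A" using that as by (auto simp: vs_def k_def nth_append)
    finally show ?thesis using A by auto
  qed
  have coord: "(P' *\<^sub>v w) $ i = 0" if w: "w \<in> W" and i: "k \<le> i" "i < n" for w i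
  proof -
    have "w \<in> span (set as)" using A w as by auto
    then obtain c where c: "w = lincomb_list c as"
      using AC as span_list_as_span[of as] by (auto simp: span_list_def)
    \<comment> \<open>The coefficients of \<open>w\<close> over the basis of \<open>W\<close>,
      padded with zeros: these are its coordinates in the whole basis.\<close>
    define d where "d = vec n (\<lambda>i. if i < k then c i else 0)"
    have "mat_of_cols n as *\<^sub>v vec k c = P *\<^sub>v d"
    proof (rule eq_vecI)
      fix r assume r: "r < dim_vec (P *\<^sub>v d)"
      then have rn: "r < n" using P by simp
      have kn: "k \<le> n" using vs by (simp add: vs_def k_def)
      have "(P *\<^sub>v d) $ r = (\<Sum>j<n. P $$ (r, j) * d $ j)"
        using P rn by (auto simp: scalar_prod_def d_def atLeast0LessThan intro!: sum.cong)
      also have "\<dots> = (\<Sum>j<k. P $$ (r, j) * d $ j)"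
        using kn by (intro sum.mono_neutral_right) (auto simp: d_def)
      also have "\<dots> = (\<Sum>j<k. as ! j $ r * c j)"
        using kn rn vs by (intro sum.cong)
          (auto simp: d_def P_def mat_of_cols_index vs_def k_def nth_append)
      also have "\<dots> = (mat_of_cols n as *\<^sub>v vec k c) $ r"
        using rn by (auto simp: scalar_prod_def k_def atLeast0LessThan mat_of_cols_index intro!: sum.cong)
      finally show "(mat_of_cols n as *\<^sub>v vec k c) $ r = (P *\<^sub>v d) $ r" ..
    qed (use P in auto)
    moreover have "w = mat_of_cols n as *\<^sub>v vec k c"
      unfolding c k_def using AC as(1) by (intro lincomb_list_as_mat_mult) auto
    ultimately have "P' *\<^sub>v w = P' *\<^sub>v (P *\<^sub>v d)" by simp
    also have "\<dots> = (P' * P) *\<^sub>v d"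
      using P P' by (intro assoc_mult_mat_vec[symmetric]) (auto simp: d_def)
    also have "\<dots> = d" using P' by (simp add: d_def)
    finally show ?thesis using i by (simp add: d_def)
  qed
  \<comment> \<open>With \<open>k = 0\<close> the subspace would be zero, and with
    \<open>k = n\<close> it would be everything; both are excluded by \<open>ne\<close>.\<close>
  have "k > 0"
  proof (rule ccontr)
    assume "\<not> ?thesis"
    then have "A = {}" using kA fin by simp
    then have "W \<subseteq> {0\<^sub>v n}" using A span_empty by auto
    moreover have "0\<^sub>v n \<in> W" using Wsub by (auto simp: submodule_def module_vec_simps)
    ultimately show False using ne by auto
  qed
  moreover have "k < n"
  proof (rule ccontr)
    assume "\<not> ?thesis"
    then have "A = B" using kA cB fin B by (metis card_seteq not_less)
    then have "carrier_vec n \<subseteq> span A" using B by simp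
    moreover have "span A \<subseteq> W"
      using span_is_subset[OF A(1)] Wsub by auto
    ultimately show False using ne WC by auto
  qed
  ultimately show ?thesis using that P P' colW coord by blast
qed

text \<open>In a basis adapted to an invariant subspace all matrices are block upper triangular. The
  diagonal blocks are then multiplicative, and the trace is the sum of their traces. Both blocks are
  smaller because the subspace is nonzero and proper.\<close>

lemma reducible_character:
  assumes G: "group G" and \<rho>: "representation G n \<rho>" and n: "n \<noteq> 0" and red: "\<not> irreducible_rep G n \<rho>"
  obtains k \<rho>1 \<rho>2 where "k < n" "n - k < n" "representation G k \<rho>1" "representation G (n - k) \<rho>2"
    "\<And>g. g \<in> carrier G \<Longrightarrow> character \<rho> g = character \<rho>1 g + character \<rho>2 g"
proof -
  interpret group G by fact
  note c = representation_closed[OF \<rho>]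
  obtain W where W: "VectorSpace.subspace class_ring W (module_vec TYPE(complex) n)"
    "W \<noteq> {0\<^sub>v n}" "W \<noteq> carrier_vec n" and inv: "\<And>g w. g \<in> carrier G \<Longrightarrow> w \<in> W \<Longrightarrow> \<rho> g *\<^sub>v w \<in> W"
    using \<rho> n red unfolding irreducible_rep_def by blast
  obtain k P P' where k: "0 < k" "k < n" and P: "P \<in> carrier_mat n n" "P' \<in> carrier_mat n n"
    "P * P' = 1\<^sub>m n" "P' * P = 1\<^sub>m n"
    and col: "\<And>j. j < k \<Longrightarrow> col P j \<in> W"
    and coord: "\<And>w i. w \<in> W \<Longrightarrow> k \<le> i \<Longrightarrow> i < n \<Longrightarrow> (P' *\<^sub>v w) $ i = 0"
    by (rule exists_adapted_basis[OF W]) blast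
  define \<sigma> where "\<sigma> g = P' * (\<rho> g * P)" for g
  have \<sigma>c: "\<sigma> g \<in> carrier_mat n n" if "g \<in> carrier G" for g
    using that unfolding \<sigma>_def by (intro mult_carrier_mat[of _ n n] P c)
  have \<sigma>1: "\<sigma> \<one>\<^bsub>G\<^esub> = 1\<^sub>m n"
    using P by (simp add: \<sigma>_def representation_one[OF G \<rho>])
  have \<sigma>m: "\<sigma> (g \<otimes>\<^bsub>G\<^esub> h) = \<sigma> g * \<sigma> h" if gh: "g \<in> carrier G" "h \<in> carrier G" for g h
  proof -
    note cc = P(1,2) c[OF gh(1)] c[OF gh(2)]
    \<comment> \<open>The inner factors \<open>P * P'\<close> of the two conjugated matrices
      cancel.\<close>
    have "\<sigma> g * \<sigma> h = P' * (\<rho> g * ((P * P') * (\<rho> h * P)))"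
      using cc unfolding \<sigma>_def
      by (simp only: assoc_mult_mat[of _ n n _ n _ n] mult_carrier_mat[of _ n n _ n])
    also have "\<dots> = \<sigma> (g \<otimes>\<^bsub>G\<^esub> h)"
      unfolding \<sigma>_def P(3) using cc gh
      by (simp add: representation_mult[OF \<rho>] assoc_mult_mat[of _ n n _ n _ n])
    finally show ?thesis ..
  qed
  \<comment> \<open>Column \<open>j < k\<close> of \<open>P\<close> lies in \<open>W\<close>, and so
    does its image under \<open>\<rho> g\<close>; the coordinates of that image from
    \<open>k\<close> onwards are zero.\<close>
  have blk: "\<sigma> g $$ (i, j) = 0" if g: "g \<in> carrier G" and ij: "k \<le> i" "i < n" "j < k" for g i j
  proof -
    have "\<sigma> g $$ (i, j) = (P' *\<^sub>v (\<rho> g *\<^sub>v col P j)) $ i"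
    proof -
      have "col (\<rho> g * P) j = \<rho> g *\<^sub>v col P j"
        using ij k P c[OF g] by (intro eq_vecI) auto
      then show ?thesis unfolding \<sigma>_def using ij k P c[OF g] by auto
    qed
    then show ?thesis using coord[OF inv[OF g col[OF ij(3)]]] ij by simp
  qed
  define \<rho>1 where "\<rho>1 g = mat k k (\<lambda>ij. \<sigma> g $$ ij)" for g
  define \<rho>2 where "\<rho>2 g = mat (n - k) (n - k) (\<lambda>(i, j). \<sigma> g $$ (k + i, k + j))" for g
  \<comment> \<open>Sums over all indices are cut at \<open>k\<close>, with the second part
    renumbered from 0 to match the indices of \<open>\<rho>2\<close>.\<close>
  have split: "(\<Sum>i<n. f i) = (\<Sum>i<k. f i) + (\<Sum>i<n-k. f (k + i))" for f :: "nat \<Rightarrow> complex"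
  proof -
    have "(\<Sum>i<n. f i) = (\<Sum>i<k. f i) + (\<Sum>i\<in>{k..<n}. f i)"
      using k by (simp add: lessThan_atLeast0 sum.atLeastLessThan_concat)
    also have "(\<Sum>i\<in>{k..<n}. f i) = (\<Sum>i<n-k. f (k + i))"
      using sum.shift_bounds_nat_ivl[of f 0 k "n - k"] k by (simp add: lessThan_atLeast0 add.commute)
    finally show ?thesis .
  qed
  have ent: "\<sigma> (g \<otimes>\<^bsub>G\<^esub> h) $$ (i, j)
      = (\<Sum>t<k. \<sigma> g $$ (i, t) * \<sigma> h $$ (t, j)) + (\<Sum>t<n-k. \<sigma> g $$ (i, k + t) * \<sigma> h $$ (k + t, j))"
    if "g \<in> carrier G" "h \<in> carrier G" "i < n" "j < n" for g h i j
    using that \<sigma>c[OF that(1)] \<sigma>c[OF that(2)]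
    unfolding \<sigma>m[OF that(1,2)] split[of "\<lambda>t. \<sigma> g $$ (i, t) * \<sigma> h $$ (t, j)", symmetric]
    by (auto simp: scalar_prod_def atLeast0LessThan intro!: sum.cong)
  have "representation G k \<rho>1"
    unfolding representation_iff[OF G]
  proof (intro conjI ballI)
    fix g h assume gh: "g \<in> carrier G" "h \<in> carrier G"
    show "\<rho>1 (g \<otimes>\<^bsub>G\<^esub> h) = \<rho>1 g * \<rho>1 h"
    proof (rule eq_matI)
      fix i j assume "i < dim_row (\<rho>1 g * \<rho>1 h)" "j < dim_col (\<rho>1 g * \<rho>1 h)"
      then have ij: "i < k" "j < k" by (auto simp: \<rho>1_def)
      \<comment> \<open>The cross term contains \<open>\<sigma> h\<close> in the vanishing lower
        left block, so only the product of the upper blocks survives.\<close>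
      have "(\<Sum>t<n-k. \<sigma> g $$ (i, k + t) * \<sigma> h $$ (k + t, j)) = 0"
        using ij gh by (intro sum.neutral) (auto simp: blk)
      then show "\<rho>1 (g \<otimes>\<^bsub>G\<^esub> h) $$ (i, j) = (\<rho>1 g * \<rho>1 h) $$ (i, j)"
        using ij k ent[OF gh, of i j] by (auto simp: \<rho>1_def scalar_prod_def atLeast0LessThan intro!: sum.cong)
    qed (auto simp: \<rho>1_def)
  qed (use k in \<open>auto simp: \<rho>1_def \<sigma>1 intro!: eq_matI\<close>)
  moreover have "representation G (n - k) \<rho>2"
    unfolding representation_iff[OF G]
  proof (intro conjI ballI)
    fix g h assume gh: "g \<in> carrier G" "h \<in> carrier G"
    show "\<rho>2 (g \<otimes>\<^bsub>G\<^esub> h) = \<rho>2 g * \<rho>2 h"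
    proof (rule eq_matI)
      fix i j assume "i < dim_row (\<rho>2 g * \<rho>2 h)" "j < dim_col (\<rho>2 g * \<rho>2 h)"
      then have ij: "i < n - k" "j < n - k" by (auto simp: \<rho>2_def)
      \<comment> \<open>Here the vanishing factor is \<open>\<sigma> g\<close>, whose row index is
        at least \<open>k\<close> while its column index is below \<open>k\<close>.\<close>
      have "(\<Sum>t<k. \<sigma> g $$ (k + i, t) * \<sigma> h $$ (t, k + j)) = 0"
        using ij gh by (intro sum.neutral) (auto simp: blk)
      then show "\<rho>2 (g \<otimes>\<^bsub>G\<^esub> h) $$ (i, j) = (\<rho>2 g * \<rho>2 h) $$ (i, j)"
        using ij k ent[OF gh, of "k + i" "k + j"] by (auto simp: \<rho>2_def scalar_prod_def atLeast0LessThan intro!: sum.cong)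
    qed (auto simp: \<rho>2_def)
  qed (use k in \<open>auto simp: \<rho>2_def \<sigma>1 intro!: eq_matI\<close>)
  moreover have "character \<rho> g = character \<rho>1 g + character \<rho>2 g" if g: "g \<in> carrier G" for g
  proof -
    have "tr (\<sigma> g) = tr (\<rho> g * P * P')"
      unfolding \<sigma>_def using P c[OF g] by (intro tr_comm) auto
    also have "\<rho> g * P * P' = \<rho> g"
      using P c[OF g] by (simp add: assoc_mult_mat[of _ n n _ n _ n])
    finally have "character \<rho> g = (\<Sum>i<n. \<sigma> g $$ (i, i))"
      using \<sigma>c[OF g] by (simp add: character_eq_tr tr_def)
    then show ?thesis by (simp add: split character_def \<rho>1_def \<rho>2_def)
  qed
  ultimately show ?thesis using that k by simp
qed

text \<open>Strong induction on the degree, splitting off blocks until they are irreducible. A list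
  is used because constituents may repeat; degree 0 gives the empty list.\<close>

lemma character_decomposition:
  assumes G: "group G" and \<rho>: "representation G n \<rho>"
  shows "\<exists>L. set L \<subseteq> irreps G \<and> (\<forall>g\<in>carrier G. character \<rho> g = (\<Sum>\<sigma>\<leftarrow>L. character \<sigma> g))"
  using \<rho>
proof (induction n arbitrary: \<rho> rule: less_induct)
  case (less n)
  consider "n = 0" | "irreducible_rep G n \<rho>" | "n \<noteq> 0" "\<not> irreducible_rep G n \<rho>" by blast
  then show ?case
  proof cases
    case 1
    have "dim_row (\<rho> g) = 0" if "g \<in> carrier G" for g
      using representation_closed[OF less.prems that] 1 by simp
    then show ?thesis by (intro exI[of _ "[]"]) (simp add: character_def)
  next
    case 2
    then show ?thesis by (intro exI[of _ "[\<rho>]"]) (auto simp: irreps_def)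
  next
    case 3
    obtain k \<rho>1 \<rho>2 where *: "k < n" "n - k < n" "representation G k \<rho>1" "representation G (n - k) \<rho>2"
      "\<And>g. g \<in> carrier G \<Longrightarrow> character \<rho> g = character \<rho>1 g + character \<rho>2 g"
      by (rule reducible_character[OF G less.prems 3]) blast
    obtain L1 L2 where "set L1 \<subseteq> irreps G" "set L2 \<subseteq> irreps G"
      "\<forall>g\<in>carrier G. character \<rho>1 g = (\<Sum>\<sigma>\<leftarrow>L1. character \<sigma> g)"
      "\<forall>g\<in>carrier G. character \<rho>2 g = (\<Sum>\<sigma>\<leftarrow>L2. character \<sigma> g)"
      using less.IH[OF *(1,3)] less.IH[OF *(2,4)] by blast
    then show ?thesis using *(5) by (intro exI[of _ "L1 @ L2"]) auto
  qed
qed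

text \<open>Left multiplication permutes the group; its permutation matrices are written along an
  enumeration \<open>e\<close> of the elements. Only the identity fixes any element, hence the
  trace.\<close>

lemma regular_representation:
  assumes G: "group G" and fin: "finite (carrier G)"
  obtains \<rho> where "representation G (card (carrier G)) \<rho>"
    "\<And>g. g \<in> carrier G \<Longrightarrow> character \<rho> g = (if g = \<one>\<^bsub>G\<^esub> then of_nat (card (carrier G)) else 0)"
proof -
  interpret group G by fact
  let ?n = "card (carrier G)"
  obtain e where e: "bij_betw e {..<?n} (carrier G)"
    using ex_bij_betw_nat_finite[OF fin] by (auto simp: atLeast0LessThan)
  have ec: "e i \<in> carrier G" if "i < ?n" for i using e that by (auto simp: bij_betw_def)
  have inj: "e i = e j \<longleftrightarrow> i = j" if "i < ?n" "j < ?n" for i j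
    using e that by (auto simp: bij_betw_def inj_on_def)
  define \<rho> :: "'a rep" where
    "\<rho> g = mat ?n ?n (\<lambda>(i, j). if e i = g \<otimes>\<^bsub>G\<^esub> e j then 1 else 0)" for g
  have "representation G ?n \<rho>"
    unfolding representation_iff[OF G]
  proof (intro conjI ballI)
    show "\<rho> \<one>\<^bsub>G\<^esub> = 1\<^sub>m ?n"
      by (rule eq_matI) (auto simp: \<rho>_def ec inj)
    fix g h assume gh: "g \<in> carrier G" "h \<in> carrier G"
    show "\<rho> (g \<otimes>\<^bsub>G\<^esub> h) = \<rho> g * \<rho> h"
    proof (rule eq_matI)
      fix i j assume "i < dim_row (\<rho> g * \<rho> h)" "j < dim_col (\<rho> g * \<rho> h)"
      then have ij: "i < ?n" "j < ?n" by (auto simp: \<rho>_def)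
      have "(\<rho> g * \<rho> h) $$ (i, j)
          = (\<Sum>t<?n. (if e i = g \<otimes>\<^bsub>G\<^esub> e t then 1 else 0) * (if e t = h \<otimes>\<^bsub>G\<^esub> e j then 1 else 0))"
        using ij by (auto simp: \<rho>_def scalar_prod_def atLeast0LessThan intro!: sum.cong)
      \<comment> \<open>Summing over group elements in place of their indices leaves the single term
        \<open>x = h e j\<close>.\<close>
      also have "\<dots> = (\<Sum>x\<in>carrier G. (if e i = g \<otimes>\<^bsub>G\<^esub> x then 1 else 0) * (if x = h \<otimes>\<^bsub>G\<^esub> e j then 1 else 0))"
        by (rule sum.reindex_bij_betw[OF e])
      also have "\<dots> = (\<Sum>x\<in>carrier G. if x = h \<otimes>\<^bsub>G\<^esub> e j then (if e i = g \<otimes>\<^bsub>G\<^esub> x then 1 else 0) else 0)"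
        by (intro sum.cong) auto
      also have "\<dots> = \<rho> (g \<otimes>\<^bsub>G\<^esub> h) $$ (i, j)"
        using fin gh ij ec by (simp add: \<rho>_def m_assoc)
      finally show "\<rho> (g \<otimes>\<^bsub>G\<^esub> h) $$ (i, j) = (\<rho> g * \<rho> h) $$ (i, j)" ..
    qed (auto simp: \<rho>_def)
  qed (auto simp: \<rho>_def)
  moreover have "character \<rho> g = (if g = \<one>\<^bsub>G\<^esub> then of_nat ?n else 0)" if g: "g \<in> carrier G" for g
  proof -
    have "e i = g \<otimes>\<^bsub>G\<^esub> e i \<longleftrightarrow> g = \<one>\<^bsub>G\<^esub>" if "i < ?n" for i
      using g ec[OF that] r_cancel_one'[of "e i" g] by auto
    then show ?thesis by (simp add: character_def \<rho>_def)
  qed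
  ultimately show ?thesis by (rule that)
qed

section \<open>Isomorphism classes and column orthogonality\<close>

lemma rep_iso_refl: "representation G n \<rho> \<Longrightarrow> rep_iso G \<rho> \<rho>"
  unfolding rep_iso_def
  by (intro exI[of _ n] conjI bexI[of _ "1\<^sub>m n"])
    (auto simp: Units_def ring_mat_simps dest!: representation_closed)

lemma rep_iso_sym:
  assumes "rep_iso G \<rho> \<sigma>"
  shows "rep_iso G \<sigma> \<rho>"
proof -
  obtain n P where r: "representation G n \<rho>" "representation G n \<sigma>"
    and "P \<in> Units (ring_mat TYPE(complex) n ())" and eq: "\<And>g. g \<in> carrier G \<Longrightarrow> P * \<rho> g = \<sigma> g * P"
    using assms unfolding rep_iso_def by blast
  then obtain P' where P': "P \<in> carrier_mat n n" "P' \<in> carrier_mat n n" "P' * P = 1\<^sub>m n" "P * P' = 1\<^sub>m n"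
    by (auto simp: Units_def ring_mat_simps)
  have "P' * \<sigma> g = \<rho> g * P'" if g: "g \<in> carrier G" for g
  proof -
    note c = representation_closed[OF r(1) g] representation_closed[OF r(2) g] P'(1,2)
    have "P' * \<sigma> g = P' * (\<sigma> g * P * P')"
      using c P' by (simp add: assoc_mult_mat[of _ n n _ n _ n])
    also have "\<dots> = P' * P * \<rho> g * P'"
      using c by (simp add: eq[OF g, symmetric] assoc_mult_mat[of _ n n _ n _ n])
    finally show ?thesis using c P' by simp
  qed
  then show ?thesis
    using r P' unfolding rep_iso_def
    by (intro exI[of _ n] conjI bexI[of _ P']) (auto simp: Units_def ring_mat_simps)
qed

lemma rep_iso_trans:
  assumes "rep_iso G \<rho> \<sigma>" "rep_iso G \<sigma> \<upsilon>" "group G"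
  shows "rep_iso G \<rho> \<upsilon>"
proof -
  interpret group G by fact
  obtain n P where r: "representation G n \<rho>" "representation G n \<sigma>"
    and P: "P \<in> Units (ring_mat TYPE(complex) n ())" "\<And>g. g \<in> carrier G \<Longrightarrow> P * \<rho> g = \<sigma> g * P"
    using assms(1) unfolding rep_iso_def by blast
  obtain m T where r': "representation G m \<sigma>" "representation G m \<upsilon>"
    and T: "T \<in> Units (ring_mat TYPE(complex) m ())" "\<And>g. g \<in> carrier G \<Longrightarrow> T * \<sigma> g = \<upsilon> g * T"
    using assms(2) unfolding rep_iso_def by blast
  \<comment> \<open>Both degrees are the size of the matrix of \<sigma> at the identity.\<close>
  have [simp]: "m = n"
    using representation_closed[OF r(2) one_closed] representation_closed[OF r'(1) one_closed] by auto
  interpret M: ring "ring_mat TYPE(complex) n ()" by (rule ring_mat)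
  have c: "P \<in> carrier_mat n n" "T \<in> carrier_mat n n"
    using P T by (auto simp: Units_def ring_mat_simps)
  have "T * P \<in> Units (ring_mat TYPE(complex) n ())"
    using M.Units_m_closed[of T P] P(1) T(1) by (simp add: ring_mat_simps)
  moreover have "T * P * \<rho> g = \<upsilon> g * (T * P)" if g: "g \<in> carrier G" for g
  proof -
    note cc = c representation_closed[OF r(1) g] representation_closed[OF r(2) g]
      representation_closed[OF r'(2) g, simplified]
    have "T * P * \<rho> g = T * \<sigma> g * P"
      using cc by (simp add: assoc_mult_mat[of _ n n _ n _ n] P(2)[OF g])
    then show ?thesis
      using cc by (simp add: assoc_mult_mat[of _ n n _ n _ n] T(2)[OF g])
  qed
  ultimately show ?thesis
    using r r' unfolding rep_iso_def by auto
qed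

lemma equiv_irrep_rel: "group G \<Longrightarrow> equiv (irreps G) (irrep_rel G)"
  by (auto simp: irrep_rel_def irreps_def intro!: equivI refl_onI symI transI
      intro: rep_iso_sym rep_iso_trans rep_iso_refl irreducible_rep_representation)

lemma irr_class_eq:
  assumes G: "group G" and c: "c \<in> irr_classes G" and \<rho>: "\<rho> \<in> c"
  shows "\<rho> \<in> irreps G" "c = irrep_rel G `` {\<rho>}"
proof -
  note eq = equiv_irrep_rel[OF G]
  obtain \<sigma> where "c = irrep_rel G `` {\<sigma>}"
    using c by (auto simp: irr_classes_def elim: quotientE)
  with \<rho> show "c = irrep_rel G `` {\<rho>}"
    using equiv_class_eq[OF eq] by auto
  show "\<rho> \<in> irreps G"
    using in_quotient_imp_subset[OF eq] c \<rho> by (auto simp: irr_classes_def)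
qed

text \<open>Characters depend only on the class, so they are independent of the representatives that
  \<open>R\<close> selects.\<close>

lemma character_irr_class:
  assumes G: "group G" and c: "c \<in> irr_classes G" and "\<rho> \<in> c" "\<sigma> \<in> c" and g: "g \<in> carrier G"
  shows "character \<rho> g = character \<sigma> g"
proof -
  have "(\<rho>, \<sigma>) \<in> irrep_rel G" using irr_class_eq(2)[OF G c \<open>\<rho> \<in> c\<close>] \<open>\<sigma> \<in> c\<close> by auto
  then show ?thesis using g by (auto simp: irrep_rel_def intro: character_rep_iso)
qed

text \<open>The regular character is a sum over a list \<open>L\<close> of irreducibles, and row
  orthogonality shows that each class occurs in \<open>L\<close> as often as its degree says.
  Degrees are positive, so every class occurs and there are finitely many; collecting
  \<open>L\<close> by classes gives the formula.\<close>

lemma regular_character: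
  assumes G: "group G" and fin: "finite (carrier G)"
    and R: "\<And>c. c \<in> irr_classes G \<Longrightarrow> R c \<in> c"
  shows "finite (irr_classes G)"
    and "g \<in> carrier G \<Longrightarrow>
      (\<Sum>c\<in>irr_classes G. character (R c) \<one>\<^bsub>G\<^esub> * character (R c) g)
      = (if g = \<one>\<^bsub>G\<^esub> then of_nat (card (carrier G)) else 0)"
proof -
  interpret group G by fact
  let ?N = "of_nat (card (carrier G)) :: complex"
  have N0: "?N \<noteq> 0" using fin by auto
  obtain \<rho> where \<rho>: "representation G (card (carrier G)) \<rho>"
    and chi: "\<And>g. g \<in> carrier G \<Longrightarrow> character \<rho> g = (if g = \<one>\<^bsub>G\<^esub> then ?N else 0)"
    by (rule regular_representation[OF G fin]) blast
  obtain L where L: "set L \<subseteq> irreps G"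
    and "\<forall>g\<in>carrier G. character \<rho> g = (\<Sum>\<sigma>\<leftarrow>L. character \<sigma> g)"
    using character_decomposition[OF G \<rho>] by blast
  then have chiL: "character \<rho> g = (\<Sum>i<length L. character (L ! i) g)" if "g \<in> carrier G" for g
    using that by (simp add: sum_list_sum_nth atLeast0LessThan)
  have mult: "character \<sigma> \<one>\<^bsub>G\<^esub> = of_nat (card {i. i < length L \<and> rep_iso G \<sigma> (L ! i)})"
    if \<sigma>: "\<sigma> \<in> irreps G" for \<sigma>
  proof -
    obtain n where n: "irreducible_rep G n \<sigma>" using \<sigma> by (auto simp: irreps_def)
    \<comment> \<open>The pairing of \<sigma> with the regular character is computed twice:
      directly, where only the identity contributes, and through the constituents in
      \<open>L\<close>.\<close>
    have "?N * character \<sigma> \<one>\<^bsub>G\<^esub>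
        = (\<Sum>g\<in>carrier G. if g = \<one>\<^bsub>G\<^esub> then character \<sigma> (inv\<^bsub>G\<^esub> g) * ?N else 0)"
      using fin by simp
    also have "\<dots> = (\<Sum>g\<in>carrier G. character \<sigma> (inv\<^bsub>G\<^esub> g) * character \<rho> g)"
      by (intro sum.cong) (auto simp: chi)
    also have "\<dots> = (\<Sum>g\<in>carrier G. \<Sum>i<length L. character \<sigma> (inv\<^bsub>G\<^esub> g) * character (L ! i) g)"
      by (simp add: chiL sum_distrib_left)
    also have "\<dots> = (\<Sum>i<length L. \<Sum>g\<in>carrier G. character \<sigma> (inv\<^bsub>G\<^esub> g) * character (L ! i) g)"
      by (rule sum.swap)
    also have "\<dots> = (\<Sum>i<length L. if rep_iso G \<sigma> (L ! i) then ?N else 0)"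
    proof (rule sum.cong[OF refl])
      fix i assume "i \<in> {..<length L}"
      then have "L ! i \<in> irreps G" using L by (auto simp: subset_iff)
      then obtain m where "irreducible_rep G m (L ! i)" by (auto simp: irreps_def)
      then show "(\<Sum>g\<in>carrier G. character \<sigma> (inv\<^bsub>G\<^esub> g) * character (L ! i) g)
          = (if rep_iso G \<sigma> (L ! i) then ?N else 0)"
        by (rule row_orthogonality[OF G n])
    qed
    also have "\<dots> = ?N * of_nat (card {i. i < length L \<and> rep_iso G \<sigma> (L ! i)})"
      by (simp add: sum.If_cases Int_def mult.commute)
    finally show ?thesis using N0 by simp
  qed
  define cl where "cl i = irrep_rel G `` {L ! i}" for i
  have cl: "cl i \<in> irr_classes G" if "i < length L" for i
    using L that by (auto simp: cl_def irr_classes_def subset_iff intro!: quotientI)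
  have iff: "rep_iso G (R c) (L ! i) \<longleftrightarrow> cl i = c" "cl i = c \<Longrightarrow> L ! i \<in> c"
    if c: "c \<in> irr_classes G" and i: "i < length L" for c i
  proof -
    have Li: "L ! i \<in> irreps G" using L i by (auto simp: subset_iff)
    note Rc = irr_class_eq[OF G c R[OF c]]
    have "L ! i \<in> cl i"
      using Li equiv_class_self[OF equiv_irrep_rel[OF G] Li] by (simp add: cl_def)
    then show 2: "cl i = c \<Longrightarrow> L ! i \<in> c" by simp
    have "rep_iso G (R c) (L ! i) \<longleftrightarrow> L ! i \<in> c"
      using Rc(1) Li by (subst Rc(2)) (auto simp: irrep_rel_def)
    also have "\<dots> \<longleftrightarrow> cl i = c"
      using irr_class_eq(2)[OF G c, of "L ! i"] 2 by (auto simp: cl_def)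
    finally show "rep_iso G (R c) (L ! i) \<longleftrightarrow> cl i = c" .
  qed
  have mult': "character (R c) \<one>\<^bsub>G\<^esub> = of_nat (card {i. i < length L \<and> cl i = c})"
    if c: "c \<in> irr_classes G" for c
  proof -
    have "{i. i < length L \<and> rep_iso G (R c) (L ! i)} = {i. i < length L \<and> cl i = c}"
      using iff(1)[OF c] by blast
    then show ?thesis using mult[OF irr_class_eq(1)[OF G c R[OF c]]] by simp
  qed
  have "irr_classes G \<subseteq> cl ` {..<length L}"
  proof
    fix c assume c: "c \<in> irr_classes G"
    obtain n where n: "irreducible_rep G n (R c)"
      using irr_class_eq(1)[OF G c R[OF c]] by (auto simp: irreps_def)
    have "character (R c) \<one>\<^bsub>G\<^esub> \<noteq> 0"
      using n character_one[OF G irreducible_rep_representation[OF n]]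
      by (simp add: irreducible_rep_def)
    \<comment> \<open>A nonzero degree is a nonzero multiplicity, so the class is met by some
      constituent.\<close>
    then have "{i. i < length L \<and> cl i = c} \<noteq> {}"
      using mult'[OF c] by (metis card.empty of_nat_0)
    then show "c \<in> cl ` {..<length L}" by auto
  qed
  then show fin': "finite (irr_classes G)" by (rule finite_subset) simp
  show "(\<Sum>c\<in>irr_classes G. character (R c) \<one>\<^bsub>G\<^esub> * character (R c) g)
      = (if g = \<one>\<^bsub>G\<^esub> then ?N else 0)" if g: "g \<in> carrier G"
  proof -
    have "(\<Sum>c\<in>irr_classes G. character (R c) \<one>\<^bsub>G\<^esub> * character (R c) g)
        = (\<Sum>c\<in>irr_classes G. \<Sum>i\<in>{i \<in> {..<length L}. cl i = c}. character (L ! i) g)"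
    proof (rule sum.cong[OF refl])
      fix c assume c: "c \<in> irr_classes G"
      have "(\<Sum>i\<in>{i \<in> {..<length L}. cl i = c}. character (L ! i) g)
          = (\<Sum>i\<in>{i \<in> {..<length L}. cl i = c}. character (R c) g)"
        using iff(2)[OF c] by (intro sum.cong refl character_irr_class[OF G c _ R[OF c] g]) auto
      then show "character (R c) \<one>\<^bsub>G\<^esub> * character (R c) g
          = (\<Sum>i\<in>{i \<in> {..<length L}. cl i = c}. character (L ! i) g)"
        by (simp add: mult'[OF c])
    qed
    \<comment> \<open>Every position of \<open>L\<close> belongs to exactly one class, so the double
      sum runs through \<open>L\<close> once.\<close>
    also have "\<dots> = (\<Sum>i<length L. character (L ! i) g)"
      by (rule sum.group) (use fin' cl in auto)
    finally show ?thesis using chiL[OF g] chi[OF g] by simp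
  qed
qed

text \<open>Counting conjugating elements covers conjugate and non-conjugate pairs uniformly, and
  these counts can later be added over the cosets of the kernel.\<close>

lemma column_orthogonality:
  assumes G: "group G" and fin: "finite (carrier G)"
    and R: "\<And>c. c \<in> irr_classes G \<Longrightarrow> R c \<in> c"
    and x: "x \<in> carrier G" and y: "y \<in> carrier G"
  shows "(\<Sum>c\<in>irr_classes G. character (R c) (inv\<^bsub>G\<^esub> x) * character (R c) y)
    = of_nat (card {h \<in> carrier G. Ad G h y = x})"
proof -
  interpret group G by fact
  let ?N = "of_nat (card (carrier G)) :: complex"
  have N0: "?N \<noteq> 0" using fin by auto
  have "?N * (\<Sum>c\<in>irr_classes G. character (R c) (inv\<^bsub>G\<^esub> x) * character (R c) y)
      = (\<Sum>c\<in>irr_classes G. \<Sum>h\<in>carrier G.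
          character (R c) \<one>\<^bsub>G\<^esub> * character (R c) (inv\<^bsub>G\<^esub> x \<otimes>\<^bsub>G\<^esub> Ad G h y))"
    unfolding sum_distrib_left
  proof (rule sum.cong[OF refl])
    fix c assume c: "c \<in> irr_classes G"
    obtain n where n: "irreducible_rep G n (R c)"
      using irr_class_eq(1)[OF G c R[OF c]] by (auto simp: irreps_def)
    show "?N * (character (R c) (inv\<^bsub>G\<^esub> x) * character (R c) y)
        = (\<Sum>h\<in>carrier G. character (R c) \<one>\<^bsub>G\<^esub> * character (R c) (inv\<^bsub>G\<^esub> x \<otimes>\<^bsub>G\<^esub> Ad G h y))"
      using character_sum_conjugates[OF G n inv_closed[OF x] y]
      by (simp add: Ad_def sum_distrib_left character_one[OF G irreducible_rep_representation[OF n]])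
  qed
  also have "\<dots> = (\<Sum>h\<in>carrier G. \<Sum>c\<in>irr_classes G.
          character (R c) \<one>\<^bsub>G\<^esub> * character (R c) (inv\<^bsub>G\<^esub> x \<otimes>\<^bsub>G\<^esub> Ad G h y))"
    by (rule sum.swap)
  \<comment> \<open>For fixed \<open>h\<close> the inner sum is the regular character at
    \<open>x\<^sup>-\<^sup>1 h y h\<^sup>-\<^sup>1\<close>, which is the identity exactly when
    \<open>h\<close> conjugates \<open>y\<close> into \<open>x\<close>.\<close>
  also have "\<dots> = (\<Sum>h\<in>carrier G. if Ad G h y = x then ?N else 0)"
  proof (rule sum.cong[OF refl])
    fix h assume h: "h \<in> carrier G"
    have A: "Ad G h y \<in> carrier G" using h y by (simp add: Ad_def)
    have "inv\<^bsub>G\<^esub> x \<otimes>\<^bsub>G\<^esub> Ad G h y = \<one>\<^bsub>G\<^esub> \<longleftrightarrow> Ad G h y = x"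
      using A x by (metis inv_closed inv_equality inv_inv r_inv l_inv)
    then show "(\<Sum>c\<in>irr_classes G.
          character (R c) \<one>\<^bsub>G\<^esub> * character (R c) (inv\<^bsub>G\<^esub> x \<otimes>\<^bsub>G\<^esub> Ad G h y))
        = (if Ad G h y = x then ?N else 0)"
      using regular_character(2)[OF G fin, of R "inv\<^bsub>G\<^esub> x \<otimes>\<^bsub>G\<^esub> Ad G h y"] R A x by simp
  qed
  also have "\<dots> = ?N * of_nat (card {h \<in> carrier G. Ad G h y = x})"
    using fin by (simp add: sum.If_cases Int_def mult.commute)
  finally show ?thesis using N0 by simp
qed

text \<open>Precomposing with a surjective endomorphism leaves the set of occurring matrices
  unchanged, and with it the invariant subspaces.\<close>

lemma irreps_automorphism:
  assumes \<phi>: "\<phi> \<in> hom G G" "\<phi> ` carrier G = carrier G" and \<rho>: "\<rho> \<in> irreps G"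
  shows "(\<lambda>g. \<rho> (\<phi> g)) \<in> irreps G"
proof -
  obtain n where n: "irreducible_rep G n \<rho>" using \<rho> by (auto simp: irreps_def)
  have "representation G n (\<lambda>g. \<rho> (\<phi> g))"
    using n hom_compose[OF \<phi>(1)] by (auto simp: irreducible_rep_def representation_def comp_def)
  moreover have "(\<forall>g\<in>carrier G. \<forall>w\<in>W. \<rho> (\<phi> g) *\<^sub>v w \<in> W) \<longleftrightarrow> (\<forall>g\<in>carrier G. \<forall>w\<in>W. \<rho> g *\<^sub>v w \<in> W)" for W
    using \<phi>(2) by (metis (no_types, lifting) image_iff)
  ultimately have "irreducible_rep G n (\<lambda>g. \<rho> (\<phi> g))"
    using n by (simp add: irreducible_rep_def)
  then show ?thesis by (auto simp: irreps_def)
qed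

section \<open>The extension\<close>

theorem theorem4p1:
  fixes H :: "'h monoid" and Q :: "'q monoid" and G :: "'h monoid"
    and j :: "'h \<Rightarrow> 'q" and s :: "'q \<Rightarrow> 'h"
    and R :: "'h rep set \<Rightarrow> 'h rep"
    and g1 g2 :: 'h
  assumes "group H" and "finite (carrier H)"
    and "group Q" and "finite (carrier Q)"
    and "j \<in> hom H Q" and "j ` carrier H = carrier Q"
    and "G = kernel_group H Q j"
    and "normalized_section H Q j s"
    and "\<And>c. c \<in> irr_classes G \<Longrightarrow> R c \<in> c"
    and "g1 \<in> carrier G" and "g2 \<in> carrier G"
  shows "(\<Sum>c\<in>irr_classes G. \<Sum>q\<in>carrier Q.
            character (R c) (inv\<^bsub>G\<^esub> g1) * character (R (q_act G H s R q c)) g2)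
       = (if conjugate_in H g1 g2 then of_nat (card (centralizer H g1)) else 0)"
proof -
  interpret H: group H by fact
  interpret Q: group Q by fact
  interpret J: group_hom H Q j by unfold_locales fact
  note R = assms(9)

  \<comment> \<open>Conjugation by \<open>H\<close> on the kernel\<close>
  have sub: "subgroup (kernel H Q j) H" by (rule J.subgroup_kernel)
  have carG: "carrier G = kernel H Q j" and multG: "x \<otimes>\<^bsub>G\<^esub> y = x \<otimes>\<^bsub>H\<^esub> y" for x y
    by (simp_all add: assms(7) kernel_group_def)
  have G: "group G" unfolding assms(7) kernel_group_def
    by (rule subgroup.subgroup_is_group[OF sub assms(1)])
  have GH: "x \<in> carrier H" "j x = \<one>\<^bsub>Q\<^esub>" if "x \<in> carrier G" for x
    using that by (auto simp: carG kernel_def)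
  have finG: "finite (carrier G)" using assms(2) GH by (auto intro: finite_subset)
  have invG: "inv\<^bsub>G\<^esub> x = inv\<^bsub>H\<^esub> x" if "x \<in> carrier G" for x
    using H.m_inv_consistent[OF sub, of x] that by (simp add: assms(7) kernel_group_def)
  have AdGH: "Ad G h x = Ad H h x" if "h \<in> carrier G" for h x
    using that by (simp add: Ad_def multG invG)
  have s: "s q \<in> carrier H" "j (s q) = q" if "q \<in> carrier Q" for q
    using assms(8) that by (auto simp: normalized_section_def)
  have cancel: "inv\<^bsub>H\<^esub> a \<otimes>\<^bsub>H\<^esub> (a \<otimes>\<^bsub>H\<^esub> b) = b" if "a \<in> carrier H" "b \<in> carrier H" for a b
    using that by (simp add: H.m_assoc[symmetric])
  have Ad_mult: "Ad H h (x \<otimes>\<^bsub>H\<^esub> y) = Ad H h x \<otimes>\<^bsub>H\<^esub> Ad H h y"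
    if "h \<in> carrier H" "x \<in> carrier H" "y \<in> carrier H" for h x y
    using that cancel by (simp add: Ad_def H.m_assoc)
  have Ad_comp: "Ad H h (Ad H k x) = Ad H (h \<otimes>\<^bsub>H\<^esub> k) x"
    if "h \<in> carrier H" "k \<in> carrier H" "x \<in> carrier H" for h k x
    using that by (simp add: Ad_def H.m_assoc H.inv_mult_group)
  have Ad_one: "Ad H \<one>\<^bsub>H\<^esub> x = x" if "x \<in> carrier H" for x
    using that by (simp add: Ad_def)
  note AdH = Ad_mult Ad_comp Ad_one
  have AdG: "Ad H h x \<in> carrier G" if "h \<in> carrier H" "x \<in> carrier G" for h x
    using that GH[OF that(2)] by (simp add: carG kernel_def Ad_def)
  \<comment> \<open>Conjugation by \<open>s q\<close> is an automorphism of the kernel, so the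
    twisted representation is irreducible and lies in the class \<open>q_act G H s R q c\<close>.
    The representative chosen there has the same character.\<close>
  have act: "character (R (q_act G H s R q c)) g2 = character (R c) (Ad H (s q) g2)"
    if c: "c \<in> irr_classes G" and q: "q \<in> carrier Q" for c q
  proof -
    let ?\<sigma> = "\<lambda>g. R c (Ad H (s q) g)"
    have "Ad H (s q) \<in> hom G G"
      using s[OF q] by (intro homI) (auto simp: AdG multG AdH GH)
    moreover have "Ad H (s q) ` carrier G = carrier G"
    proof
      show "carrier G \<subseteq> Ad H (s q) ` carrier G"
      proof
        fix x assume x: "x \<in> carrier G"
        show "x \<in> Ad H (s q) ` carrier G"
          using s[OF q] x GH[OF x]
          by (intro image_eqI[of _ _ "Ad H (inv\<^bsub>H\<^esub> (s q)) x"]) (auto simp: AdG AdH)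
      qed
    qed (use s[OF q] AdG in auto)
    ultimately have \<sigma>: "?\<sigma> \<in> irreps G"
      by (rule irreps_automorphism) (rule irr_class_eq(1)[OF G c R[OF c]])
    have d: "q_act G H s R q c \<in> irr_classes G"
      using \<sigma> by (auto simp: q_act_def irr_classes_def intro!: quotientI)
    have "?\<sigma> \<in> q_act G H s R q c"
      unfolding q_act_def by (rule equiv_class_self[OF equiv_irrep_rel[OF G] \<sigma>])
    then show ?thesis
      using character_irr_class[OF G d R[OF d] _ assms(11)] by (simp add: character_def)
  qed

  \<comment> \<open>Counting the elements that conjugate \<open>g2\<close> into
    \<open>g1\<close>\<close>
  let ?T = "{h \<in> carrier H. Ad H h g2 = g1}"
  let ?F = "\<lambda>q. {g \<in> carrier G. Ad H g (Ad H (s q) g2) = g1}"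
  have "(\<Sum>c\<in>irr_classes G. \<Sum>q\<in>carrier Q.
            character (R c) (inv\<^bsub>G\<^esub> g1) * character (R (q_act G H s R q c)) g2)
      = (\<Sum>q\<in>carrier Q. \<Sum>c\<in>irr_classes G.
            character (R c) (inv\<^bsub>G\<^esub> g1) * character (R c) (Ad H (s q) g2))"
    by (subst sum.swap) (simp add: act)
  also have "\<dots> = (\<Sum>q\<in>carrier Q. of_nat (card (?F q)))"
  proof (rule sum.cong[OF refl])
    fix q assume q: "q \<in> carrier Q"
    have "{h \<in> carrier G. Ad G h (Ad H (s q) g2) = g1} = ?F q" using AdGH by auto
    then show "(\<Sum>c\<in>irr_classes G. character (R c) (inv\<^bsub>G\<^esub> g1) * character (R c) (Ad H (s q) g2))
        = of_nat (card (?F q))"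
      using column_orthogonality[OF G finG _ assms(10) AdG[OF s(1)[OF q] assms(11)], of R] R by simp
  qed
  also have "\<dots> = of_nat (card (SIGMA q:carrier Q. ?F q))"
    using assms(4) finG by (simp add: card_SigmaI)
  also have "card (SIGMA q:carrier Q. ?F q) = card ?T"
  proof (rule bij_betw_same_card)
    \<comment> \<open>The values of \<open>s\<close> form a transversal of the kernel, so each
      \<open>h\<close> is \<open>g s(q)\<close> for a unique pair, with
      \<open>q = j h\<close>.\<close>
    show "bij_betw (\<lambda>(q, g). g \<otimes>\<^bsub>H\<^esub> s q) (SIGMA q:carrier Q. ?F q) ?T"
    proof (rule bij_betwI[where g = "\<lambda>h. (j h, h \<otimes>\<^bsub>H\<^esub> inv\<^bsub>H\<^esub> (s (j h)))"])
      show "(\<lambda>(q, g). g \<otimes>\<^bsub>H\<^esub> s q) \<in> (SIGMA q:carrier Q. ?F q) \<rightarrow> ?T"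
        using s GH assms(11) by (auto simp: AdH)
      show "(\<lambda>h. (j h, h \<otimes>\<^bsub>H\<^esub> inv\<^bsub>H\<^esub> (s (j h)))) \<in> ?T \<rightarrow> (SIGMA q:carrier Q. ?F q)"
      proof
        fix h assume h: "h \<in> ?T"
        define q where "q = j h"
        have q: "q \<in> carrier Q" using h by (simp add: q_def)
        have "h \<otimes>\<^bsub>H\<^esub> inv\<^bsub>H\<^esub> (s q) \<in> carrier G"
          using h s[OF q] by (simp add: carG kernel_def q_def)
        moreover have "Ad H (h \<otimes>\<^bsub>H\<^esub> inv\<^bsub>H\<^esub> (s q)) (Ad H (s q) g2) = g1"
          using h s[OF q] GH(1)[OF assms(11)] by (simp add: AdH H.m_assoc)
        ultimately show "(j h, h \<otimes>\<^bsub>H\<^esub> inv\<^bsub>H\<^esub> (s (j h))) \<in> (SIGMA q:carrier Q. ?F q)"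
          using q by (simp add: q_def)
      qed
    qed (use s GH in \<open>auto simp: H.m_assoc\<close>)
  qed
  also have "card ?T = (if conjugate_in H g1 g2 then card (centralizer H g1) else 0)"
  proof (cases "conjugate_in H g1 g2")
    case True
    then obtain k where k: "k \<in> carrier H" "Ad H k g1 = g2" by (auto simp: conjugate_in_def)
    note g = GH(1)[OF assms(10)] GH(1)[OF assms(11)]
    have k': "Ad H (inv\<^bsub>H\<^esub> k) g2 = g1"
      using k g by (auto simp: AdH k(2)[symmetric])
    have cent: "h \<in> centralizer H g1 \<longleftrightarrow> h \<in> carrier H \<and> Ad H h g1 = g1" for h
      using g H.inv_solve_right'[of g1 "h \<otimes>\<^bsub>H\<^esub> g1" h] by (auto simp: centralizer_def Ad_def)
    \<comment> \<open>As \<open>k\<close> carries \<open>g1\<close> to \<open>g2\<close> and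
      \<open>h\<close> carries \<open>g2\<close> back, \<open>h k\<close> fixes \<open>g1\<close>
      under conjugation: \<open>?T\<close> is a translate of the centralizer.\<close>
    have "bij_betw (\<lambda>h. h \<otimes>\<^bsub>H\<^esub> k) ?T (centralizer H g1)"
    proof (rule bij_betwI[where g = "\<lambda>h. h \<otimes>\<^bsub>H\<^esub> inv\<^bsub>H\<^esub> k"])
      show "(\<lambda>h. h \<otimes>\<^bsub>H\<^esub> k) \<in> ?T \<rightarrow> centralizer H g1"
        using k g by (auto simp: cent Ad_comp[symmetric])
      show "(\<lambda>h. h \<otimes>\<^bsub>H\<^esub> inv\<^bsub>H\<^esub> k) \<in> centralizer H g1 \<rightarrow> ?T"
        using k g k' by (auto simp: cent Ad_comp[symmetric])
    qed (use k in \<open>auto simp: H.m_assoc cent\<close>)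
    then show ?thesis using True by (simp add: bij_betw_same_card)
  next
    case False
    have "?T = {}"
    proof (rule ccontr)
      assume "?T \<noteq> {}"
      then obtain h where h: "h \<in> carrier H" "Ad H h g2 = g1" by blast
      \<comment> \<open>The inverse of an element taking \<open>g2\<close> to \<open>g1\<close>
        would witness the excluded conjugacy.\<close>
      have "Ad H (inv\<^bsub>H\<^esub> h) g1 = g2"
        using h GH(1)[OF assms(11)] by (auto simp: AdH h(2)[symmetric])
      then show False using False h by (auto simp: conjugate_in_def)
    qed
    with False show ?thesis by (simp only: card.empty if_False)
  qed
  finally show ?thesis by simp
qed

end
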